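(* Let $x>1$ be fixed, and put $h=x/(x-1)$ and $s_0=\log h$ (real logarithm, so $s_0>0$). Then as $n\to\infty$, \[ B_n^{(n)}(nx)\sim \frac{n!}{\sqrt{2\pi n}}\,\frac{(x-1)^{n-1}}{\log\,(x/(x-1))} \Bigl(\frac{x}{x-1}\Bigr)^{nx-1/2} \sum_{k=0}^\infty \frac{2^k(\tfrac12)_k }{n^k}\,A_k(h,s_0), \] where $B_n^{(n)}$ and the coefficients $A_k(H,\lambda)$ are as defined in the context.
   Context: The generalised Bernoulli polynomials $B_n^{(\mu)}(z)$ are defined by $\bigl(\frac{t}{e^t-1}\bigr)^{\mu} e^{zt}=\sum_{n=0}^\infty B_n^{(\mu)}(z)\frac{t^n}{n!}$ for $|t|<2\pi$; here $\mu=n$. $(a)_k=a(a+1)\cdots(a+k-1)$ is the Pochhammer symbol. The symbol $\sim$ denotes an asymptotic expansion in the Poincaré sense. Coefficients $A_k(H,\lambda)$: for complex $H\notin\{0,1\}$ and complex $\lambda\neq0$, let $c=i(H-1)H^{-1/2}$ (for a fixed choice of the square root), and let $t(w)=cw+\sum_{m\ge2}c_mw^m$ be the formal power series solution of \[\log\frac{He^t-1}{H-1}-\frac{tH}{H-1}=\tfrac12 w^2 .\] (This is $\psi(s_0+t)-\psi(s_0)=\tfrac12w^2$ with $\psi(s)=\log(e^s-1)-sz$, $z=H/(H-1)$, $e^{s_0}=H$.) Expand the formal series $\frac{t'(w)}{\lambda+t(w)}=\frac{c}{\lambda}\sum_{m\ge0}a_mw^m$ and set $A_k(H,\lambda)=a_{2k}$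 (these do not depend on the choice of square root). In particular $A_0=1$, \[A_1(H,\lambda)=\frac{1}{12H}\Bigl\{-(1-H+H^2)+\frac{6(H^2-1)}{\lambda}-\frac{12(H-1)^2}{\lambda^2}\Bigr\},\] \[A_2(H,\lambda)=\frac{1}{864H^2}\Bigl\{(1-H+H^2)^2-\frac{12}{\lambda}(H^2-1)(3-5H+3H^2)+\frac{120}{\lambda^2}(H-1)^2(2+H+2H^2)-\frac{720}{\lambda^3}(H+1)(H-1)^3+\frac{864}{\lambda^4}(H-1)^4\Bigr\},\] \[A_3(H,\lambda)=\frac{1}{777600H^3}\Bigl\{\Upsilon(H)+\frac{90}{\lambda}(H^2-1)(1-H+H^2)(5-9H+5H^2)-\frac{1260}{\lambda^2}(H-1)^2(13-8H-3H^2-8H^3+13H^4)+\frac{15120}{\lambda^3}(H-1)^3(H+1)(8-5H+8H^2)-\frac{453600}{\lambda^4}(H-1)^4(1+H+H^2)+\frac{907200}{\lambda^5}(H-1)^5(H+1)-\frac{777600}{\lambda^6}(H-1)^6\Bigr\},\] with $\Upsilon(H)=139-417H+402H^2-109H^3+402H^4-417H^5+139H^6$. *)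

theory Defs
  imports "HOL-Analysis.Analysis" "HOL-Computational_Algebra.Formal_Power_Series"
    "HOL-Library.Landau_Symbols"
begin

text \<open>Generalised Bernoulli polynomials B_n^(mu)(z) (mu a natural number), as
  n! times the n-th coefficient of the formal power series (t/(e^t-1))^mu e^(zt).
  Here (e^t - 1)/t is fps_shift 1 (fps_exp 1 - 1), which has constant term 1.\<close>
definition gen_bernoulli :: "nat \<Rightarrow> nat \<Rightarrow> real \<Rightarrow> real" where
  "gen_bernoulli n mu z =
     fact n * fps_nth ((inverse (fps_shift 1 (fps_exp 1 - 1))) ^ mu * fps_exp z) n"

text \<open>The formal power series in t of log((H e^t - 1)/(H-1)) - tH/(H-1),
  using (H e^t - 1)/(H-1) = 1 + (H/(H-1)) (e^t - 1).\<close>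
definition psiF :: "complex \<Rightarrow> complex fps" where
  "psiF H = fps_compose (fps_ln 1) (fps_const (H/(H-1)) * (fps_exp 1 - 1))
            - fps_const (H/(H-1)) * fps_X"

definition cH :: "complex \<Rightarrow> complex" where
  "cH H = \<i> * (H - 1) / csqrt H"

definition tser :: "complex \<Rightarrow> complex fps" where
  "tser H = (THE T. fps_nth T 0 = 0 \<and> fps_nth T 1 = cH H \<and>
                    fps_compose (psiF H) T = fps_const (1/2) * fps_X ^ 2)"

definition A_coeff :: "nat \<Rightarrow> complex \<Rightarrow> complex \<Rightarrow> complex" where
  "A_coeff k H lam =
     fps_nth (fps_const (lam / cH H) * fps_deriv (tser H) * inverse (fps_const lam + tser H)) (2 * k)"

end

theory Submission
  imports Defs "HOL-Complex_Analysis.Complex_Analysis" "HOL-Probability.Distributions"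
    "HOL-Real_Asymp.Real_Asymp"
begin

text \<open>The value B_n^(n)(nx)/n! is the residue at 0 of u(t)^n / t with u(t) = e^(xt) / (e^t - 1), whose
  saddle point is s_0. Since s_0 may exceed 2 pi, the contour is the rectangle with vertical
  sides on Re t = -R and Re t = s_0 and horizontal sides on Im t = -pi, pi; it encloses no other pole,
  and |u| < u(s_0) on three sides, so only the side through s_0 matters. There
  u(s_0 + t) = u(s_0) e^(-W(t)^2/2) with W analytic at 0, and the Taylor series of W is the
  compositional inverse of the formal series t(w). Hence, for G(w) = t'(w)/(s_0 + t(w)) truncated to a
  polynomial P of degree < 2N, 1/(s_0 + t) = P(W(t)) W'(t) + O(t^(2N)): the first term yields Gaussian
  moments, the second is O(n^(-N-1/2)) by |u(s_0 + i y)| <= u(s_0) e^(-k y^2).\<close>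

section \<open>Gaussian moments\<close>

text \<open>The vertical side is in general only tangent to the steepest descent path at s_0, so W(i
  y) need not be real. It is nevertheless kept as the path: exp(-n w^2/2) w^m has an entire
  primitive, so the integral of exp(-n W^2/2) W^m W' depends only on the values of W at the two ends
  of a short segment. The inverse t(w) enters only as a formal series. A polynomial truncation in w
  is pulled back by W, so the inverse need not be evaluated at any point. For h > 1 the constant c =
  i (h-1)/sqrt h is imaginary. Hence real w corresponds to vertical t to first order, i W'(0) is
  positive, and the factor i of c cancels the -i that comes from dt = i dy. The even truncation
  degree 2N fits the moments: odd ones vanish, so degrees below 2N give N terms, and a remainder of
  order t^(2N) is as small as the moment of index 2N, namely n^(-N-1/2), which is n^(-N) times the
  leading order.\<close>

definition gauss_moment :: "nat \<Rightarrow> real \<Rightarrow> real" where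
  "gauss_moment m a =
     (if even m then sqrt (2 * pi / a) * (fact m / (2 ^ (m div 2) * fact (m div 2))) / a ^ (m div 2) else 0)"

lemma has_bochner_integral_gauss_moment:
  assumes "a > 0"
  shows "has_bochner_integral lborel (\<lambda>x. exp (- a * x\<^sup>2 / 2) * x ^ m) (gauss_moment m a)"
proof -
  define \<sigma> where "\<sigma> = 1 / sqrt a"
  have \<sigma>: "\<sigma> > 0" "\<sigma>\<^sup>2 = 1 / a" using assms by (auto simp: \<sigma>_def power_divide)
  define c where "c = sqrt (2 * pi / a)"
  have c: "c > 0" using assms by (simp add: c_def)
  have nd: "normal_density 0 \<sigma> x = exp (- a * x\<^sup>2 / 2) / c" for x
    by (simp add: normal_density_def \<sigma> c_def mult_ac)
  have "has_bochner_integral lborel (\<lambda>x. normal_density 0 \<sigma> x * x ^ m) (gauss_moment m a / c)"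
  proof (cases "even m")
    case True
    then obtain k where k: "m = 2 * k" by (elim evenE)
    have "has_bochner_integral lborel (\<lambda>x. normal_density 0 \<sigma> x * x ^ m) (fact (2 * k) / ((2 / \<sigma>\<^sup>2) ^ k * fact k))"
      using normal_moment_even[OF \<sigma>(1), of 0 k] by (simp add: k)
    also have "fact (2 * k) / ((2 / \<sigma>\<^sup>2) ^ k * fact k) = gauss_moment m a / c"
      using c by (simp add: gauss_moment_def k \<sigma>(2) power_mult_distrib flip: c_def)
    finally show ?thesis .
  next
    case False
    then obtain k where k: "m = 2 * k + 1" by (elim oddE)
    show ?thesis using normal_moment_odd[OF \<sigma>(1), of 0 k] by (simp add: k gauss_moment_def)
  qed
  from has_bochner_integral_mult_left[OF this, of c] show ?thesis
    using c by (simp add: nd mult_ac)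
qed

text \<open>Outside the interval |x| >= l, so part a - 1 of the exponent is bounded by its value at
  l while one unit is kept back for integrability. The integral that remains is the absolute moment
  at a = 1, so the constant does not depend on a.\<close>

lemma gauss_moment_tail:
  assumes "l > 0" "\<alpha> \<le> - l" "l \<le> \<beta>"
  obtains C where "\<And>a. a \<ge> 1 \<Longrightarrow>
    \<bar>gauss_moment m a - (\<integral>x. indicator {\<alpha>..\<beta>} x * (exp (- a * x\<^sup>2 / 2) * x ^ m) \<partial>lborel)\<bar>
      \<le> C * exp (- (l\<^sup>2 / 2) * a)"
proof (rule that)
  fix a :: real assume a: "a \<ge> 1"
  let ?f = "\<lambda>a x. exp (- a * x\<^sup>2 / 2) * x ^ m :: real"
  let ?J = "\<integral>x. \<bar>?f 1 x\<bar> \<partial>lborel"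
  have int: "integrable lborel (?f a)" "has_bochner_integral lborel (?f a) (gauss_moment m a)" if "a \<ge> 1" for a
    using has_bochner_integral_gauss_moment[of a m] that by (auto intro: integrable.intros)
  have int': "integrable lborel (\<lambda>x. indicator {\<alpha>..\<beta>} x * ?f a x)"
    using integrable_mult_indicator[OF _ int(1)[OF a], of "{\<alpha>..\<beta>}"] by simp
  have eq: "gauss_moment m a - (\<integral>x. indicator {\<alpha>..\<beta>} x * ?f a x \<partial>lborel)
      = (\<integral>x. ?f a x - indicator {\<alpha>..\<beta>} x * ?f a x \<partial>lborel)"
    using int[OF a] int' by (simp add: has_bochner_integral_integral_eq)
  have "\<bar>\<integral>x. ?f a x - indicator {\<alpha>..\<beta>} x * ?f a x \<partial>lborel\<bar> \<le> (\<integral>x. exp (- (l\<^sup>2 / 2) * (a - 1)) * \<bar>?f 1 x\<bar> \<partial>lborel)"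
  proof (rule integral_abs_bound_integral)
    show "integrable lborel (\<lambda>x. ?f a x - indicator {\<alpha>..\<beta>} x * ?f a x)"
      using int[OF a] int' by simp
    show "integrable lborel (\<lambda>x. exp (- (l\<^sup>2 / 2) * (a - 1)) * \<bar>?f 1 x\<bar>)"
      using int(1)[of 1] by (intro integrable_mult_right integrable_abs) auto
    fix x :: real
    show "\<bar>?f a x - indicator {\<alpha>..\<beta>} x * ?f a x\<bar> \<le> exp (- (l\<^sup>2 / 2) * (a - 1)) * \<bar>?f 1 x\<bar>"
    proof (cases "x \<in> {\<alpha>..\<beta>}")
      case False
      then have "\<bar>l\<bar> \<le> \<bar>x\<bar>" using assms by auto
      then have "l\<^sup>2 \<le> x\<^sup>2" by (simp only: abs_le_square_iff)
      then have "l\<^sup>2 * (a - 1) \<le> x\<^sup>2 * (a - 1)" using a by (intro mult_right_mono) auto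
      then have "- a * x\<^sup>2 / 2 \<le> - (l\<^sup>2 / 2) * (a - 1) + - 1 * x\<^sup>2 / 2" by (simp add: field_simps)
      then have "exp (- a * x\<^sup>2 / 2) \<le> exp (- (l\<^sup>2 / 2) * (a - 1)) * exp (- 1 * x\<^sup>2 / 2)"
        by (simp only: exp_add[symmetric] exp_le_cancel_iff)
      then have "exp (- a * x\<^sup>2 / 2) * \<bar>x ^ m\<bar> \<le> exp (- (l\<^sup>2 / 2) * (a - 1)) * exp (- 1 * x\<^sup>2 / 2) * \<bar>x ^ m\<bar>"
        by (rule mult_right_mono) simp
      then show ?thesis using False by (simp add: abs_mult mult_ac)
    qed simp
  qed
  also have "\<dots> = exp (l\<^sup>2 / 2) * ?J * exp (- (l\<^sup>2 / 2) * a)"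
  proof -
    have "exp (- (l\<^sup>2 / 2) * (a - 1)) = exp (l\<^sup>2 / 2) * exp (- (l\<^sup>2 / 2) * a)"
      by (simp only: exp_add[symmetric] right_diff_distrib) simp
    then show ?thesis by (simp only: integral_mult_right_zero mult_ac)
  qed
  finally show "\<bar>gauss_moment m a - (\<integral>x. indicator {\<alpha>..\<beta>} x * ?f a x \<partial>lborel)\<bar>
     \<le> exp (l\<^sup>2 / 2) * ?J * exp (- (l\<^sup>2 / 2) * a)" unfolding eq .
qed

text \<open>On the vertical segment from b to Re b the cone condition gives Re(w^2) >= (1 - 1/4) (Re
  b)^2, which is where the rate 3/8 comes from. The remaining factors come from |w| <= |b| and from
  the length |Im b| <= |b|.\<close>

lemma gauss_primitive_real_shift:
  fixes b :: complex
  assumes b: "\<bar>Im b\<bar> \<le> \<bar>Re b\<bar> / 2" and a: "a \<ge> 0"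
  assumes F: "\<And>w. (F has_field_derivative exp (- of_real a * w\<^sup>2 / 2) * w ^ m) (at w)"
  shows "norm (F b - F (of_real (Re b))) \<le> norm b ^ Suc m * exp (- (3 / 8 * (Re b)\<^sup>2) * a)"
proof -
  let ?S = "closed_segment b (of_real (Re b))"
  have "norm (F b - F (of_real (Re b))) \<le> (norm b ^ m * exp (- (3 / 8 * (Re b)\<^sup>2) * a)) * norm (b - of_real (Re b))"
  proof (rule field_differentiable_bound[where S = ?S])
    show "(F has_field_derivative exp (- of_real a * w\<^sup>2 / 2) * w ^ m) (at w within ?S)" for w
      using F by (rule has_field_derivative_at_within)
    fix w assume w: "w \<in> ?S"
    then have Re: "Re w = Re b" and Im: "\<bar>Im w\<bar> \<le> \<bar>Im b\<bar>"
      by (auto simp: closed_segment_same_Re closed_segment_eq_real_ivl split: if_splits)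
    have n: "norm w \<le> norm b"
      unfolding cmod_def using Re Im by (intro real_sqrt_le_mono add_mono) (auto simp: abs_le_square_iff)
    have "\<bar>Im w\<bar> \<le> \<bar>Re b / 2\<bar>" using Im b by simp
    then have "(Im w)\<^sup>2 \<le> (Re b / 2)\<^sup>2" by (simp only: abs_le_square_iff)
    then have "Re (w\<^sup>2) \<ge> 3 / 4 * (Re b)\<^sup>2" by (simp add: Re_power2 Re power_divide)
    then have "Re (- of_real a * w\<^sup>2 / 2) \<le> - (3 / 8 * (Re b)\<^sup>2) * a"
      using mult_left_mono[OF _ a, of "3 / 4 * (Re b)\<^sup>2" "Re (w\<^sup>2)"] by simp
    then show "norm (exp (- of_real a * w\<^sup>2 / 2) * w ^ m) \<le> norm b ^ m * exp (- (3 / 8 * (Re b)\<^sup>2) * a)"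
      unfolding norm_mult norm_exp_eq_Re norm_power using n
      by (subst mult.commute) (intro mult_mono power_mono, auto)
  qed auto
  also have "\<dots> \<le> (norm b ^ m * exp (- (3 / 8 * (Re b)\<^sup>2) * a)) * norm b"
    using abs_Im_le_cmod[of b] by (intro mult_left_mono) (auto simp: cmod_def)
  finally show ?thesis by (simp add: mult_ac)
qed

text \<open>The endpoints lie in the cone where exp(-a w^2/2) decays, so they can be moved to the real axis at
  an exponentially small cost, although the curve joining them need not be real.\<close>
lemma gauss_primitive_asymp:
  fixes u v :: complex
  assumes u: "Re u < 0" "\<bar>Im u\<bar> \<le> \<bar>Re u\<bar> / 2" and v: "Re v > 0" "\<bar>Im v\<bar> \<le> \<bar>Re v\<bar> / 2"
  shows "\<exists>\<rho>>0. \<exists>C. \<forall>a F. a \<ge> 1 \<longrightarrow>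
     (\<forall>w. (F has_field_derivative exp (- of_real a * w\<^sup>2 / 2) * w ^ m) (at w)) \<longrightarrow>
     norm (F v - F u - of_real (gauss_moment m a)) \<le> C * exp (- \<rho> * a)"
proof -
  define l where "l = min (- Re u) (Re v)"
  have l: "l > 0" "Re u \<le> - l" "l \<le> Re v" using u v by (auto simp: l_def)
  obtain C where C: "\<And>a. a \<ge> 1 \<Longrightarrow>
    \<bar>gauss_moment m a - (\<integral>x. indicator {Re u..Re v} x * (exp (- a * x\<^sup>2 / 2) * x ^ m) \<partial>lborel)\<bar>
      \<le> C * exp (- (l\<^sup>2 / 2) * a)" using gauss_moment_tail[OF l, where m = m] by blast
  \<comment> \<open>The rate 3/8 of the two vertical shifts is smaller than the rate 1/2 of the real
    tail, so one exponent covers all three errors.\<close>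
  define \<rho> where "\<rho> = 3 / 8 * l\<^sup>2"
  have C0: "C \<ge> 0"
  proof -
    have "0 \<le> C * exp (- (l\<^sup>2 / 2) * 1)" using order_trans[OF abs_ge_zero C[of 1]] by simp
    then show ?thesis by (simp only: zero_le_mult_iff) (simp add: not_le[symmetric])
  qed
  show ?thesis
  proof (rule exI[of _ \<rho>], intro conjI exI[of _ "C + norm v ^ Suc m + norm u ^ Suc m"] allI impI)
    show "\<rho> > 0" using l by (simp add: \<rho>_def)
    fix a :: real and F :: "complex \<Rightarrow> complex" assume a: "a \<ge> 1"
      and "\<forall>w. (F has_field_derivative exp (- of_real a * w\<^sup>2 / 2) * w ^ m) (at w)"
    then have F: "\<And>w. (F has_field_derivative exp (- of_real a * w\<^sup>2 / 2) * w ^ m) (at w)" by blast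
    have lsq: "l\<^sup>2 \<le> (Re u)\<^sup>2" "l\<^sup>2 \<le> (Re v)\<^sup>2"
      using l by (auto simp: abs_le_square_iff[symmetric])
    have "(\<integral>x. indicator {Re u..Re v} x *\<^sub>R complex_of_real (exp (- a * x\<^sup>2 / 2) * x ^ m) \<partial>lborel)
       = F (of_real (Re v)) - F (of_real (Re u))"
    proof (rule integral_FTC_Icc)
      show "Re u \<le> Re v" using u v by simp
      show "continuous_on {Re u..Re v} (\<lambda>x. complex_of_real (exp (- a * x\<^sup>2 / 2) * x ^ m))"
        by (intro continuous_intros) auto
      fix x :: real
      have "((\<lambda>x. F (of_real x)) has_vector_derivative exp (- of_real a * (of_real x)\<^sup>2 / 2) * of_real x ^ m) (at x within {Re u..Re v})"
        by (rule has_vector_derivative_real_field) (rule F)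
      moreover have "exp (- of_real a * (of_real x)\<^sup>2 / 2) * of_real x ^ m = complex_of_real (exp (- a * x\<^sup>2 / 2) * x ^ m)"
        by (simp flip: exp_of_real)
      ultimately show "((\<lambda>x. F (of_real x)) has_vector_derivative complex_of_real (exp (- a * x\<^sup>2 / 2) * x ^ m)) (at x within {Re u..Re v})" by metis
    qed
    moreover have "(\<integral>x. indicator {Re u..Re v} x *\<^sub>R complex_of_real (exp (- a * x\<^sup>2 / 2) * x ^ m) \<partial>lborel)
       = complex_of_real (\<integral>x. indicator {Re u..Re v} x * (exp (- a * x\<^sup>2 / 2) * x ^ m) \<partial>lborel)"
      unfolding integral_complex_of_real[symmetric] by (simp add: scaleR_conv_of_real)
    ultimately have I: "F (of_real (Re v)) - F (of_real (Re u)) =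
      complex_of_real (\<integral>x. indicator {Re u..Re v} x * (exp (- a * x\<^sup>2 / 2) * x ^ m) \<partial>lborel)" by simp
    have e: "exp (- (k * x) * a) \<le> exp (- \<rho> * a)" if "k \<ge> 3 / 8" "x \<ge> l\<^sup>2" for k x
      using mult_mono[OF that] that a by (simp add: \<rho>_def mult_right_mono)
    have "norm (F (of_real (Re v)) - F (of_real (Re u)) - of_real (gauss_moment m a)) \<le> C * exp (- (1 / 2 * l\<^sup>2) * a)"
      unfolding I of_real_diff[symmetric] norm_of_real using C[OF a] by (simp add: abs_minus_commute)
    also have "\<dots> \<le> C * exp (- \<rho> * a)" using C0 by (intro mult_left_mono e) auto
    finally have 1: "norm (F (of_real (Re v)) - F (of_real (Re u)) - of_real (gauss_moment m a)) \<le> C * exp (- \<rho> * a)" .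
    have 2: "norm (F b - F (of_real (Re b))) \<le> norm b ^ Suc m * exp (- \<rho> * a)" if "b = u \<or> b = v" for b
    proof -
      have "norm (F b - F (of_real (Re b))) \<le> norm b ^ Suc m * exp (- (3 / 8 * (Re b)\<^sup>2) * a)"
        using that u v a F by (intro gauss_primitive_real_shift) auto
      also have "\<dots> \<le> norm b ^ Suc m * exp (- \<rho> * a)" using that lsq by (intro mult_left_mono e) auto
      finally show ?thesis .
    qed
    have eq: "F v - F u - of_real (gauss_moment m a) =
       (F (of_real (Re v)) - F (of_real (Re u)) - of_real (gauss_moment m a)) + (F v - F (of_real (Re v))) - (F u - F (of_real (Re u)))"
      by simp
    have "norm (F v - F u - of_real (gauss_moment m a))
        \<le> C * exp (- \<rho> * a) + norm v ^ Suc m * exp (- \<rho> * a) + norm u ^ Suc m * exp (- \<rho> * a)"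
    proof -
      have tri: "norm (p + q - r) \<le> norm p + norm q + norm r" for p q r :: complex
        using norm_triangle_ineq4[of "p + q" r] norm_triangle_ineq[of p q] by linarith
      show ?thesis unfolding eq by (rule order_trans[OF tri add_mono[OF add_mono[OF 1 2[of v]] 2[of u]]]) simp_all
    qed
    then show "norm (F v - F u - of_real (gauss_moment m a)) \<le> (C + norm v ^ Suc m + norm u ^ Suc m) * exp (- \<rho> * a)"
      by (simp add: algebra_simps)
  qed
qed

section \<open>Laplace's method along an imaginary segment\<close>

lemma exp_decay_bigo: "\<rho> > 0 \<Longrightarrow> (\<lambda>n::nat. exp (- \<rho> * real n)) \<in> O(\<lambda>n. 1 / (real n ^ N * sqrt (real n)))"
  by real_asymp

text \<open>The order n^(-N-1/2) is the leading factor n^(-1/2) times the desired relative error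
  n^(-N). Every error term below is measured on this scale.\<close>

lemma gauss_moment_scaled_bigo:
  assumes "k > 0"
  shows "(\<lambda>n::nat. gauss_moment (2 * N) (k * real n)) \<in> O(\<lambda>n. 1 / (real n ^ N * sqrt (real n)))"
proof -
  define K where "K = sqrt (2 * pi / k) * (fact (2 * N) / (2 ^ N * fact N)) / k ^ N"
  have "gauss_moment (2 * N) (k * real n) = K * (1 / (real n ^ N * sqrt (real n)))" for n
    by (simp add: gauss_moment_def K_def real_sqrt_divide real_sqrt_mult power_mult_distrib)
  then have "norm (gauss_moment (2 * N) (k * real n)) \<le> \<bar>K\<bar> * norm (1 / (real n ^ N * sqrt (real n)))" for n
    by (simp only: real_norm_def abs_mult order_refl)
  then show ?thesis by (intro bigoI[where c = "\<bar>K\<bar>"] always_eventually allI)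
qed

text \<open>Since i W'(0) is a positive real, W(i \<theta>) is close to \<mu> \<theta> for small
  \<theta>, so the images of both ends of a short vertical segment lie in the cones around the two
  halves of the real axis where the Gaussian decays.\<close>

lemma saddle_endpoints:
  fixes W :: "complex \<Rightarrow> complex"
  assumes W: "(W has_field_derivative w1) (at 0)" "W 0 = 0" and \<mu>: "\<i> * w1 = of_real \<mu>" "\<mu> > 0" and r: "r > 0"
  obtains \<epsilon> where "0 < \<epsilon>" "\<epsilon> < r"
    "Re (W (- \<i> * of_real \<epsilon>)) < 0" "\<bar>Im (W (- \<i> * of_real \<epsilon>))\<bar> \<le> \<bar>Re (W (- \<i> * of_real \<epsilon>))\<bar> / 2"
    "Re (W (\<i> * of_real \<epsilon>)) > 0" "\<bar>Im (W (\<i> * of_real \<epsilon>))\<bar> \<le> \<bar>Re (W (\<i> * of_real \<epsilon>))\<bar> / 2"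
proof -
  have "((\<lambda>z. W z / z) \<longlongrightarrow> w1) (at 0)"
    using W by (simp add: has_field_derivative_iff)
  then have "\<forall>\<^sub>F z in at 0. dist (W z / z) w1 < \<mu> / 4" using \<mu>(2) by (intro tendstoD) auto
  then obtain d where d: "d > 0" "\<And>z. z \<noteq> 0 \<Longrightarrow> norm z < d \<Longrightarrow> dist (W z / z) w1 < \<mu> / 4"
    by (auto simp: eventually_at)
  define \<epsilon> where "\<epsilon> = min d r / 2"
  have \<epsilon>: "0 < \<epsilon>" "\<epsilon> < r" "\<epsilon> < d" using d r by (auto simp: \<epsilon>_def)
  have close: "norm (W z - w1 * z) \<le> \<mu> / 4 * \<epsilon>" if "norm z = \<epsilon>" for z
  proof -
    have z: "z \<noteq> 0" using that \<epsilon> by auto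
    have "norm (W z - w1 * z) = norm (W z / z - w1) * norm z"
      using z by (simp add: norm_mult[symmetric] algebra_simps)
    also have "\<dots> \<le> \<mu> / 4 * \<epsilon>"
      using d(2)[OF z] that \<epsilon> \<mu>(2) by (intro mult_mono) (auto simp: dist_norm)
    finally show ?thesis .
  qed
  have e: "w1 * (\<i> * of_real \<epsilon>) = of_real (\<mu> * \<epsilon>)" "w1 * (- \<i> * of_real \<epsilon>) = - of_real (\<mu> * \<epsilon>)"
    by (simp_all flip: \<mu>(1) add: mult_ac)
  have c: "norm (W (\<i> * of_real \<epsilon>) - of_real (\<mu> * \<epsilon>)) \<le> \<mu> * \<epsilon> / 4"
               "norm (W (- \<i> * of_real \<epsilon>) - - of_real (\<mu> * \<epsilon>)) \<le> \<mu> * \<epsilon> / 4"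
    using close[of "\<i> * of_real \<epsilon>"] close[of "- \<i> * of_real \<epsilon>"] \<epsilon>(1) unfolding e
    by (simp_all add: norm_mult)
  have pos: "\<mu> * \<epsilon> > 0" using \<mu> \<epsilon> by simp
  \<comment> \<open>A relative error of 1/4 leaves Re w >= 3k/4 and |Im w| <= k/4, a slope of at
    most 1/3.\<close>
  have cone: "Re w > 0 \<and> \<bar>Im w\<bar> \<le> \<bar>Re w\<bar> / 2" if "norm (w - of_real k) \<le> k / 4" "k > 0" for w :: complex and k
  proof -
    have "\<bar>Re w - k\<bar> \<le> k / 4" "\<bar>Im w\<bar> \<le> k / 4"
      using order_trans[OF abs_Re_le_cmod that(1)] order_trans[OF abs_Im_le_cmod that(1)] by simp_all
    then show ?thesis using that(2) by linarith
  qed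
  have "norm (- W (- \<i> * of_real \<epsilon>) - of_real (\<mu> * \<epsilon>)) \<le> \<mu> * \<epsilon> / 4"
    using c(2) by (subst norm_minus_cancel[symmetric]) (simp add: algebra_simps)
  from cone[OF this pos] cone[OF c(1) pos] show ?thesis
    by (elim conjE, intro that[OF \<epsilon>(1,2)]) simp_all
qed

text \<open>Up to the factor i from dt = i d\<theta>, the integrand is the derivative of F(W(i
  \<theta>)) with F an entire primitive of the Gaussian times a power. Only the endpoint values of F
  matter, and they reproduce the full moment with an exponentially small error. The bound is stated
  on the power scale so that it adds to the other errors.\<close>

lemma gauss_integral_along_curve:
  fixes W :: "complex \<Rightarrow> complex"
  assumes W: "W holomorphic_on ball 0 r" and \<epsilon>: "0 < \<epsilon>" "\<epsilon> < r"
    and ends: "Re (W (- \<i> * of_real \<epsilon>)) < 0" "\<bar>Im (W (- \<i> * of_real \<epsilon>))\<bar> \<le> \<bar>Re (W (- \<i> * of_real \<epsilon>))\<bar> / 2"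
    "Re (W (\<i> * of_real \<epsilon>)) > 0" "\<bar>Im (W (\<i> * of_real \<epsilon>))\<bar> \<le> \<bar>Re (W (\<i> * of_real \<epsilon>))\<bar> / 2"
  shows "(\<lambda>n::nat. integral {-\<epsilon>..\<epsilon>} (\<lambda>\<theta>. exp (- of_nat n * (W (\<i> * of_real \<theta>))\<^sup>2 / 2) * W (\<i> * of_real \<theta>) ^ m * deriv W (\<i> * of_real \<theta>))
            - (- \<i> * of_real (gauss_moment m (real n)))) \<in> O(\<lambda>n. of_real (1 / (real n ^ N * sqrt (real n))))"
    (is "(\<lambda>n. ?I n - _) \<in> _")
proof -
  \<comment> \<open>The constants are fixed before \<open>a\<close> and \<open>F\<close>, hence
    uniform in n, although the primitive chosen below changes with n.\<close>
  obtain \<rho> C where \<rho>: "\<rho> > 0" and C: "\<forall>a F. a \<ge> 1 \<longrightarrow>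
     (\<forall>w. (F has_field_derivative exp (- of_real a * w\<^sup>2 / 2) * w ^ m) (at w)) \<longrightarrow>
     norm (F (W (\<i> * of_real \<epsilon>)) - F (W (- \<i> * of_real \<epsilon>)) - of_real (gauss_moment m a)) \<le> C * exp (- \<rho> * a)"
    using gauss_primitive_asymp[OF ends, of m] by blast
  have bound: "norm (?I n - (- \<i> * of_real (gauss_moment m (real n)))) \<le> C * norm (exp (- \<rho> * real n))" if n: "n \<ge> 1" for n
  proof -
    have "(\<lambda>w. exp (- of_real (real n) * w\<^sup>2 / 2) * w ^ m) holomorphic_on UNIV"
      by (intro holomorphic_intros) auto
    then obtain F where F: "\<And>w::complex. (F has_field_derivative exp (- of_real (real n) * w\<^sup>2 / 2) * w ^ m) (at w)"
      using holomorphic_convex_primitive'[of UNIV "\<lambda>w. exp (- of_real (real n) * w\<^sup>2 / 2) * w ^ m"] by auto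
    have dW: "(W has_field_derivative deriv W z) (at z)" if "z \<in> ball 0 r" for z
      using W that by (intro holomorphic_derivI[of W "ball 0 r"]) auto
    let ?f = "\<lambda>\<theta>. exp (- of_nat n * (W (\<i> * of_real \<theta>))\<^sup>2 / 2) * W (\<i> * of_real \<theta>) ^ m * deriv W (\<i> * of_real \<theta>)"
    have "((\<lambda>\<theta>. ?f \<theta> * \<i>) has_integral F (W (\<i> * of_real \<epsilon>)) - F (W (\<i> * of_real (- \<epsilon>)))) {-\<epsilon>..\<epsilon>}"
    proof (rule fundamental_theorem_of_calculus)
      show "-\<epsilon> \<le> \<epsilon>" using \<epsilon> by simp
      fix \<theta> :: real assume "\<theta> \<in> {-\<epsilon>..\<epsilon>}"
      then have z: "\<i> * of_real \<theta> \<in> ball 0 r" using \<epsilon> by (auto simp: norm_mult)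
      have "((\<lambda>t. \<i> * t) has_field_derivative \<i>) (at (of_real \<theta>))"
        by (auto intro!: derivative_eq_intros)
      from DERIV_chain2[where f = W and g = "\<lambda>t. \<i> * t" and x = "of_real \<theta>", OF dW[OF z] this]
      have "((\<lambda>t. W (\<i> * t)) has_field_derivative deriv W (\<i> * of_real \<theta>) * \<i>) (at (of_real \<theta>))" .
      from DERIV_chain2[where f = F and g = "\<lambda>t. W (\<i> * t)" and x = "of_real \<theta>", OF F this]
      have "((\<lambda>t. F (W (\<i> * t))) has_field_derivative ?f \<theta> * \<i>) (at (of_real \<theta>))"
        by (simp add: mult.assoc)
      then show "((\<lambda>t. F (W (\<i> * of_real t))) has_vector_derivative ?f \<theta> * \<i>) (at \<theta> within {-\<epsilon>..\<epsilon>})"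
        by (rule has_vector_derivative_real_field)
    qed
    then have "((\<lambda>\<theta>. ?f \<theta> * \<i> * (- \<i>)) has_integral (F (W (\<i> * of_real \<epsilon>)) - F (W (\<i> * of_real (- \<epsilon>)))) * (- \<i>)) {-\<epsilon>..\<epsilon>}"
      by (rule has_integral_mult_left)
    then have "?I n = (F (W (\<i> * of_real \<epsilon>)) - F (W (- \<i> * of_real \<epsilon>))) * (- \<i>)"
      by (intro integral_unique) (simp add: mult.assoc)
    then have "?I n - (- \<i> * of_real (gauss_moment m (real n))) =
       (F (W (\<i> * of_real \<epsilon>)) - F (W (- \<i> * of_real \<epsilon>)) - of_real (gauss_moment m (real n))) * (- \<i>)"
      by (simp add: algebra_simps)
    also have "norm \<dots> \<le> C * norm (exp (- \<rho> * real n))"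
      using C[rule_format, OF _ F] n by (simp add: norm_mult)
    finally show ?thesis .
  qed
  have "(\<lambda>n::nat. ?I n - (- \<i> * of_real (gauss_moment m (real n)))) \<in> O(\<lambda>n. complex_of_real (exp (- \<rho> * real n)))"
    by (rule bigoI[where c = C]) (use bound in \<open>auto intro!: eventually_sequentiallyI[of 1]\<close>)
  also have "(\<lambda>n::nat. complex_of_real (exp (- \<rho> * real n))) \<in> O(\<lambda>n. complex_of_real (1 / (real n ^ N * sqrt (real n))))"
    unfolding landau_o.big.of_real_iff using \<rho> by (rule exp_decay_bigo)
  finally show ?thesis .
qed

text \<open>An amplitude that vanishes to order 2N at the saddle is integrated against at most
  exp(-\<kappa> n \<theta>^2), so the integral is dominated by the Gaussian moment of index 2N with
  parameter 2 \<kappa> n.\<close>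

lemma laplace_remainder_bigo:
  fixes g q :: "real \<Rightarrow> complex"
  assumes "0 < \<epsilon>" "continuous_on {-\<epsilon>..\<epsilon>} g" "continuous_on {-\<epsilon>..\<epsilon>} q"
    and g: "\<And>\<theta>. \<bar>\<theta>\<bar> \<le> \<epsilon> \<Longrightarrow> norm (g \<theta>) \<le> C * \<bar>\<theta>\<bar> ^ (2 * N)"
    and q: "\<kappa> > 0" "\<And>\<theta>. \<bar>\<theta>\<bar> \<le> \<epsilon> \<Longrightarrow> norm (q \<theta>) \<le> exp (- \<kappa> * \<theta>\<^sup>2)"
  shows "(\<lambda>n::nat. integral {-\<epsilon>..\<epsilon>} (\<lambda>\<theta>. q \<theta> ^ n * g \<theta>)) \<in> O(\<lambda>n. of_real (1 / (real n ^ N * sqrt (real n))))"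
proof -
  define C' where "C' = \<bar>C\<bar>"
  have bound: "norm (integral {-\<epsilon>..\<epsilon>} (\<lambda>\<theta>. q \<theta> ^ n * g \<theta>)) \<le> C' * norm (gauss_moment (2 * N) (2 * \<kappa> * real n))"
    if n: "n \<ge> 1" for n :: nat
  proof -
    let ?h = "\<lambda>\<theta>. exp (- (2 * \<kappa> * real n) * \<theta>\<^sup>2 / 2) * \<theta> ^ (2 * N)"
    have B: "has_bochner_integral lborel ?h (gauss_moment (2 * N) (2 * \<kappa> * real n))"
      using q(1) n by (intro has_bochner_integral_gauss_moment) auto
    have H: "(?h has_integral gauss_moment (2 * N) (2 * \<kappa> * real n)) UNIV"
      using has_integral_integral_lborel[OF integrable.intros[OF B]] has_bochner_integral_integral_eq[OF B] by simp
    have int: "?h integrable_on {-\<epsilon>..\<epsilon>}"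
      by (intro integrable_continuous_interval continuous_intros) auto
    have "norm (integral {-\<epsilon>..\<epsilon>} (\<lambda>\<theta>. q \<theta> ^ n * g \<theta>)) \<le> integral {-\<epsilon>..\<epsilon>} (\<lambda>\<theta>. C' * ?h \<theta>)"
    proof (rule integral_norm_bound_integral)
      show "(\<lambda>\<theta>. q \<theta> ^ n * g \<theta>) integrable_on {-\<epsilon>..\<epsilon>}"
        using assms by (intro integrable_continuous_interval continuous_intros)
      show "(\<lambda>\<theta>. C' * ?h \<theta>) integrable_on {-\<epsilon>..\<epsilon>}"
        by (intro integrable_continuous_interval continuous_intros) auto
      fix \<theta> assume "\<theta> \<in> {-\<epsilon>..\<epsilon>}"
      then have \<theta>: "\<bar>\<theta>\<bar> \<le> \<epsilon>" by auto
      have "norm (q \<theta> ^ n) \<le> exp (- \<kappa> * \<theta>\<^sup>2) ^ n"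
        unfolding norm_power using q(2)[OF \<theta>] by (intro power_mono) auto
      also have "\<dots> = exp (- (2 * \<kappa> * real n) * \<theta>\<^sup>2 / 2)"
        by (simp add: exp_of_nat_mult[symmetric] mult_ac)
      finally have 1: "norm (q \<theta> ^ n) \<le> exp (- (2 * \<kappa> * real n) * \<theta>\<^sup>2 / 2)" .
      have 2: "norm (g \<theta>) \<le> C' * \<theta> ^ (2 * N)"
      proof -
        have "norm (g \<theta>) \<le> C * \<bar>\<theta>\<bar> ^ (2 * N)" using g[OF \<theta>] .
        also have "\<dots> \<le> C' * \<bar>\<theta>\<bar> ^ (2 * N)" unfolding C'_def by (intro mult_right_mono) auto
        finally show ?thesis by (simp add: power_even_abs)
      qed
      show "norm (q \<theta> ^ n * g \<theta>) \<le> C' * ?h \<theta>"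
        unfolding norm_mult by (rule order_trans[OF mult_mono[OF 1 2]]) (simp_all add: mult_ac)
    qed
    also have "\<dots> = C' * integral {-\<epsilon>..\<epsilon>} ?h" by simp
    also have "\<dots> \<le> C' * gauss_moment (2 * N) (2 * \<kappa> * real n)"
    proof (rule mult_left_mono)
      have "integral {-\<epsilon>..\<epsilon>} ?h \<le> integral UNIV ?h"
        using int H by (intro integral_subset_le) auto
      then show "integral {-\<epsilon>..\<epsilon>} ?h \<le> gauss_moment (2 * N) (2 * \<kappa> * real n)"
        using integral_unique[OF H] by simp
    qed (simp add: C'_def)
    also have "\<dots> \<le> C' * norm (gauss_moment (2 * N) (2 * \<kappa> * real n))"
      by (intro mult_left_mono) (auto simp: C'_def)
    finally show ?thesis .
  qed
  have "(\<lambda>n::nat. integral {-\<epsilon>..\<epsilon>} (\<lambda>\<theta>. q \<theta> ^ n * g \<theta>)) \<in> O(\<lambda>n. complex_of_real (gauss_moment (2 * N) (2 * \<kappa> * real n)))"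
    by (rule bigoI[where c = C']) (use bound in \<open>auto intro!: eventually_sequentiallyI[of 1]\<close>)
  also have "(\<lambda>n::nat. complex_of_real (gauss_moment (2 * N) (2 * \<kappa> * real n))) \<in> O(\<lambda>n. complex_of_real (1 / (real n ^ N * sqrt (real n))))"
    unfolding landau_o.big.of_real_iff using q(1) by (intro gauss_moment_scaled_bigo) simp
  finally show ?thesis .
qed

lemma laplace_tail_bigo:
  fixes f q :: "real \<Rightarrow> complex"
  assumes "continuous_on {a..b} f" "continuous_on {a..b} q"
    and q: "\<kappa> > 0" "\<And>\<theta>. \<theta> \<in> {a..b} \<Longrightarrow> norm (q \<theta>) \<le> exp (- \<kappa>)"
  shows "(\<lambda>n::nat. integral {a..b} (\<lambda>\<theta>. q \<theta> ^ n * f \<theta>)) \<in> O(\<lambda>n. of_real (1 / (real n ^ N * sqrt (real n))))"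
proof -
  obtain M where M: "\<And>\<theta>. \<theta> \<in> {a..b} \<Longrightarrow> norm (f \<theta>) \<le> M"
    using compact_imp_bounded[OF compact_continuous_image[OF assms(1) compact_Icc]]
    unfolding bounded_iff by blast
  have bound: "norm (integral {a..b} (\<lambda>\<theta>. q \<theta> ^ n * f \<theta>)) \<le> (\<bar>M\<bar> * \<bar>b - a\<bar>) * norm (exp (- \<kappa> * real n))" for n
  proof (cases "a \<le> b")
    case True
    have "norm (integral {a..b} (\<lambda>\<theta>. q \<theta> ^ n * f \<theta>)) \<le> (exp (- \<kappa> * real n) * \<bar>M\<bar>) * (b - a)"
    proof (rule integral_bound[OF True])
      show "continuous_on {a..b} (\<lambda>\<theta>. q \<theta> ^ n * f \<theta>)" using assms by (intro continuous_intros)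
      fix \<theta> assume \<theta>: "\<theta> \<in> {a..b}"
      have "norm (q \<theta> ^ n) \<le> exp (- \<kappa>) ^ n"
        unfolding norm_power using q(2)[OF \<theta>] by (intro power_mono) auto
      also have "\<dots> = exp (- \<kappa> * real n)"
        by (simp add: exp_of_nat_mult[symmetric] mult_ac)
      finally show "norm (q \<theta> ^ n * f \<theta>) \<le> exp (- \<kappa> * real n) * \<bar>M\<bar>"
        unfolding norm_mult using M[OF \<theta>] by (intro mult_mono) auto
    qed
    also have "\<dots> = (\<bar>M\<bar> * \<bar>b - a\<bar>) * norm (exp (- \<kappa> * real n))" using True by simp
    finally show ?thesis .
  qed simp
  have "(\<lambda>n::nat. integral {a..b} (\<lambda>\<theta>. q \<theta> ^ n * f \<theta>)) \<in> O(\<lambda>n. complex_of_real (exp (- \<kappa> * real n)))"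
    by (rule bigoI[where c = "\<bar>M\<bar> * \<bar>b - a\<bar>"]) (use bound in auto)
  also have "(\<lambda>n::nat. complex_of_real (exp (- \<kappa> * real n))) \<in> O(\<lambda>n. complex_of_real (1 / (real n ^ N * sqrt (real n))))"
    unfolding landau_o.big.of_real_iff using q(1) by (rule exp_decay_bigo)
  finally show ?thesis .
qed

text \<open>The interval is cut at -\<epsilon> and \<epsilon>. The outer pieces are exponentially
  small. On the inner one f is replaced by P(W) W' with P the polynomial with coefficients
  \<open>G\<close>; the replacement costs a remainder of order 2N, and the rest is a combination of
  the exact curve integrals. The hypotheses on f and q quantify over t = i \<theta> because f and q
  live on a real interval while W is only known to be analytic near 0 in the plane.\<close>

lemma laplace_saddle:
  fixes W :: "complex \<Rightarrow> complex" and f q :: "real \<Rightarrow> complex"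
  assumes L: "L > 0" and cont: "continuous_on {-L..L} f" "continuous_on {-L..L} q"
    and q: "\<kappa> > 0" "\<And>\<theta>. \<bar>\<theta>\<bar> \<le> L \<Longrightarrow> norm (q \<theta>) \<le> exp (- \<kappa> * \<theta>\<^sup>2)"
    and W: "W analytic_on {0}" "W 0 = 0" and \<mu>: "\<i> * deriv W 0 = of_real \<mu>" "\<mu> > 0"
    and qW: "\<forall>\<^sub>F t in nhds 0. \<forall>\<theta>. t = \<i> * of_real \<theta> \<longrightarrow> q \<theta> = exp (- (W t)\<^sup>2 / 2)"
    and fW: "\<forall>\<^sub>F t in nhds 0. \<forall>\<theta>. t = \<i> * of_real \<theta> \<longrightarrow>
       norm (f \<theta> - (\<Sum>m<2*N. G m * W t ^ m) * deriv W t) \<le> C * norm t ^ (2 * N)"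
  shows "(\<lambda>n::nat. integral {-L..L} (\<lambda>\<theta>. q \<theta> ^ n * f \<theta>)
           - (- \<i>) * (\<Sum>m<2*N. G m * of_real (gauss_moment m (real n))))
         \<in> O(\<lambda>n. of_real (1 / (real n ^ N * sqrt (real n))))"
proof -
  obtain r0 where r0: "r0 > 0" "W holomorphic_on ball 0 r0"
    using W(1) by (auto simp: analytic_on_def)
  obtain r1 where r1: "r1 > 0" "\<And>\<theta>. norm (\<i> * of_real \<theta> :: complex) < r1 \<Longrightarrow> q \<theta> = exp (- (W (\<i> * of_real \<theta>))\<^sup>2 / 2)"
    using qW by (auto simp: eventually_nhds_metric dist_norm)
  obtain r2 where r2: "r2 > 0" "\<And>\<theta>. norm (\<i> * of_real \<theta> :: complex) < r2 \<Longrightarrow>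
      norm (f \<theta> - (\<Sum>m<2*N. G m * W (\<i> * of_real \<theta>) ^ m) * deriv W (\<i> * of_real \<theta>)) \<le> C * norm (\<i> * of_real \<theta> :: complex) ^ (2 * N)"
    using fW by (auto simp: eventually_nhds_metric dist_norm)
  define r where "r = Min {r0, r1, r2, L}"
  have r: "r > 0" "r \<le> r0" "r \<le> r1" "r \<le> r2" "r \<le> L" using r0 r1 r2 L by (auto simp: r_def)
  have dW: "(W has_field_derivative deriv W 0) (at 0)"
    using r0 by (intro holomorphic_derivI[of W "ball 0 r0"]) auto
  obtain \<epsilon> where \<epsilon>: "0 < \<epsilon>" "\<epsilon> < r" and ends:
    "Re (W (- \<i> * of_real \<epsilon>)) < 0" "\<bar>Im (W (- \<i> * of_real \<epsilon>))\<bar> \<le> \<bar>Re (W (- \<i> * of_real \<epsilon>))\<bar> / 2"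
    "Re (W (\<i> * of_real \<epsilon>)) > 0" "\<bar>Im (W (\<i> * of_real \<epsilon>))\<bar> \<le> \<bar>Re (W (\<i> * of_real \<epsilon>))\<bar> / 2"
    by (rule saddle_endpoints[OF dW W(2) \<mu> r(1)])
  have holo: "W holomorphic_on ball 0 r" using r0(2) by (rule holomorphic_on_subset) (use r in auto)
  define P where "P = (\<lambda>\<theta>::real. (\<Sum>m<2*N. G m * W (\<i> * of_real \<theta>) ^ m) * deriv W (\<i> * of_real \<theta>))"
  have img: "(\<lambda>\<theta>::real. \<i> * of_real \<theta>) ` {-\<epsilon>..\<epsilon>} \<subseteq> ball 0 r" using \<epsilon> by (auto simp: norm_mult)
  have cW: "continuous_on {-\<epsilon>..\<epsilon>} (\<lambda>\<theta>. W (\<i> * of_real \<theta>))"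
    by (rule continuous_on_compose2[OF holomorphic_on_imp_continuous_on[OF holo] _ img]) (intro continuous_intros)
  have cdW: "continuous_on {-\<epsilon>..\<epsilon>} (\<lambda>\<theta>. deriv W (\<i> * of_real \<theta>))"
    by (rule continuous_on_compose2[OF holomorphic_on_imp_continuous_on[OF holomorphic_deriv[OF holo open_ball]] _ img]) (intro continuous_intros)
  have sub: "{-\<epsilon>..\<epsilon>} \<subseteq> {-L..L}" "{-L..-\<epsilon>} \<subseteq> {-L..L}" "{\<epsilon>..L} \<subseteq> {-L..L}" using \<epsilon> r by auto
  have cP: "continuous_on {-\<epsilon>..\<epsilon>} P" unfolding P_def using cW cdW by (intro continuous_intros)
  note c1 = continuous_on_subset[OF cont(1) sub(1)] continuous_on_subset[OF cont(2) sub(1)]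
  note c2 = continuous_on_subset[OF cont(1) sub(2)] continuous_on_subset[OF cont(2) sub(2)]
  note c3 = continuous_on_subset[OF cont(1) sub(3)] continuous_on_subset[OF cont(2) sub(3)]
  let ?O = "O(\<lambda>n::nat. complex_of_real (1 / (real n ^ N * sqrt (real n))))"
  have tail: "norm (q \<theta>) \<le> exp (- (\<kappa> * \<epsilon>\<^sup>2))" if "\<bar>\<theta>\<bar> \<le> L" "\<bar>\<epsilon>\<bar> \<le> \<bar>\<theta>\<bar>" for \<theta>
  proof -
    have "norm (q \<theta>) \<le> exp (- \<kappa> * \<theta>\<^sup>2)" by (rule q(2)[OF that(1)])
    also have "\<dots> \<le> exp (- (\<kappa> * \<epsilon>\<^sup>2))" using that(2) q(1) by (simp add: abs_le_square_iff)
    finally show ?thesis .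
  qed
  have T1: "(\<lambda>n::nat. integral {-L..-\<epsilon>} (\<lambda>\<theta>. q \<theta> ^ n * f \<theta>)) \<in> ?O"
    by (rule laplace_tail_bigo[OF c2, of "\<kappa> * \<epsilon>\<^sup>2"]) (use q(1) \<epsilon> tail in auto)
  have T2: "(\<lambda>n::nat. integral {\<epsilon>..L} (\<lambda>\<theta>. q \<theta> ^ n * f \<theta>)) \<in> ?O"
    by (rule laplace_tail_bigo[OF c3, of "\<kappa> * \<epsilon>\<^sup>2"]) (use q(1) \<epsilon> tail in auto)
  have T3: "(\<lambda>n::nat. integral {-\<epsilon>..\<epsilon>} (\<lambda>\<theta>. q \<theta> ^ n * (f \<theta> - P \<theta>))) \<in> ?O"
  proof (rule laplace_remainder_bigo[OF \<epsilon>(1) _ c1(2) _ q(1), where C = C])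
    show "continuous_on {-\<epsilon>..\<epsilon>} (\<lambda>\<theta>. f \<theta> - P \<theta>)" using c1(1) cP by (rule continuous_on_diff)
    fix \<theta> :: real assume "\<bar>\<theta>\<bar> \<le> \<epsilon>"
    then show "norm (f \<theta> - P \<theta>) \<le> C * \<bar>\<theta>\<bar> ^ (2 * N)" "norm (q \<theta>) \<le> exp (- \<kappa> * \<theta>\<^sup>2)"
      using r2(2)[of \<theta>] q(2)[of \<theta>] \<epsilon> r by (auto simp: P_def norm_mult)
  qed
  let ?I = "\<lambda>m (n::nat). integral {-\<epsilon>..\<epsilon>} (\<lambda>\<theta>. exp (- of_nat n * (W (\<i> * of_real \<theta>))\<^sup>2 / 2) * W (\<i> * of_real \<theta>) ^ m * deriv W (\<i> * of_real \<theta>))"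
  have T4: "(\<lambda>n. \<Sum>m<2*N. G m * (?I m n - (- \<i> * of_real (gauss_moment m (real n))))) \<in> ?O"
  proof (rule big_sum_in_bigo)
    fix m
    have "(\<lambda>n. ?I m n - (- \<i> * of_real (gauss_moment m (real n)))) \<in> ?O"
      by (rule gauss_integral_along_curve[OF holo \<epsilon> ends])
    then show "(\<lambda>n. G m * (?I m n - (- \<i> * of_real (gauss_moment m (real n))))) \<in> ?O"
      by (simp only: cmult_in_bigo_iff simp_thms)
  qed
  \<comment> \<open>An exact identity: the four summands are precisely the quantities estimated in
    \<open>T1\<close>, \<open>T3\<close>, \<open>T4\<close> and \<open>T2\<close>.\<close>
  have split: "integral {-L..L} (\<lambda>\<theta>. q \<theta> ^ n * f \<theta>) - (- \<i>) * (\<Sum>m<2*N. G m * of_real (gauss_moment m (real n)))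
    = integral {-L..-\<epsilon>} (\<lambda>\<theta>. q \<theta> ^ n * f \<theta>) + integral {-\<epsilon>..\<epsilon>} (\<lambda>\<theta>. q \<theta> ^ n * (f \<theta> - P \<theta>))
      + (\<Sum>m<2*N. G m * (?I m n - (- \<i> * of_real (gauss_moment m (real n))))) + integral {\<epsilon>..L} (\<lambda>\<theta>. q \<theta> ^ n * f \<theta>)" for n :: nat
  proof -
    have int: "(\<lambda>\<theta>. q \<theta> ^ n * f \<theta>) integrable_on {-L..L}"
      using cont by (intro integrable_continuous_interval continuous_intros)
    have "integral {-L..L} (\<lambda>\<theta>. q \<theta> ^ n * f \<theta>) = integral {-L..-\<epsilon>} (\<lambda>\<theta>. q \<theta> ^ n * f \<theta>)
       + integral {-\<epsilon>..L} (\<lambda>\<theta>. q \<theta> ^ n * f \<theta>)"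
      using \<epsilon> r int by (intro Henstock_Kurzweil_Integration.integral_combine[symmetric]) auto
    also have "integral {-\<epsilon>..L} (\<lambda>\<theta>. q \<theta> ^ n * f \<theta>) = integral {-\<epsilon>..\<epsilon>} (\<lambda>\<theta>. q \<theta> ^ n * f \<theta>)
       + integral {\<epsilon>..L} (\<lambda>\<theta>. q \<theta> ^ n * f \<theta>)"
      using \<epsilon> r by (intro Henstock_Kurzweil_Integration.integral_combine[symmetric] integrable_subinterval_real[OF int]) auto
    also have "integral {-\<epsilon>..\<epsilon>} (\<lambda>\<theta>. q \<theta> ^ n * f \<theta>) =
       integral {-\<epsilon>..\<epsilon>} (\<lambda>\<theta>. q \<theta> ^ n * (f \<theta> - P \<theta>) + q \<theta> ^ n * P \<theta>)"
      by (simp add: algebra_simps)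
    also have "\<dots> = integral {-\<epsilon>..\<epsilon>} (\<lambda>\<theta>. q \<theta> ^ n * (f \<theta> - P \<theta>)) + integral {-\<epsilon>..\<epsilon>} (\<lambda>\<theta>. q \<theta> ^ n * P \<theta>)"
      using c1 cP by (intro Henstock_Kurzweil_Integration.integral_add integrable_continuous_interval continuous_intros)
    also have "integral {-\<epsilon>..\<epsilon>} (\<lambda>\<theta>. q \<theta> ^ n * P \<theta>) = integral {-\<epsilon>..\<epsilon>} (\<lambda>\<theta>. \<Sum>m<2*N. G m *
       (exp (- of_nat n * (W (\<i> * of_real \<theta>))\<^sup>2 / 2) * W (\<i> * of_real \<theta>) ^ m * deriv W (\<i> * of_real \<theta>)))"
    proof (rule integral_cong)
      fix \<theta> assume "\<theta> \<in> {-\<epsilon>..\<epsilon>}"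
      then have "q \<theta> = exp (- (W (\<i> * of_real \<theta>))\<^sup>2 / 2)" using r1(2)[of \<theta>] \<epsilon> r by (auto simp: norm_mult)
      then have "q \<theta> ^ n = exp (- of_nat n * (W (\<i> * of_real \<theta>))\<^sup>2 / 2)"
        by (simp add: exp_of_nat_mult[symmetric])
      then show "q \<theta> ^ n * P \<theta> = (\<Sum>m<2*N. G m *
       (exp (- of_nat n * (W (\<i> * of_real \<theta>))\<^sup>2 / 2) * W (\<i> * of_real \<theta>) ^ m * deriv W (\<i> * of_real \<theta>)))"
        by (simp only: P_def sum_distrib_left sum_distrib_right mult_ac)
    qed
    also have "\<dots> = (\<Sum>m<2*N. G m * ?I m n)"
      using cW cdW by (subst Henstock_Kurzweil_Integration.integral_sum)
        (auto intro!: integrable_continuous_interval continuous_intros)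
    finally show ?thesis
      by (simp add: algebra_simps sum_subtractf sum_distrib_left sum.distrib sum_negf)
  qed
  show ?thesis unfolding split
    by (intro sum_in_bigo T1 T2 T3 T4)
qed

section \<open>The saddle point coordinate and the formal inverse series\<close>

lemma has_fps_expansion_Ln1p: "(\<lambda>u::complex. Ln (1 + u)) has_fps_expansion fps_ln 1"
proof (rule has_fps_expansionI)
  have "\<forall>\<^sub>F u in nhds (0::complex). u \<in> ball 0 1"
    by (intro eventually_nhds_in_open) auto
  then show "\<forall>\<^sub>F u in nhds (0::complex). (\<lambda>n. fps_nth (fps_ln 1) n * u ^ n) sums Ln (1 + u)"
  proof eventually_elim
    case (elim u)
    have "(\<lambda>n. (-1) ^ Suc n / of_nat n * u ^ n) sums Ln (1 + u)"
      using Ln_series[of u] elim by simp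
    \<comment> \<open>At n = 0 both sides are 0, the left one by the convention that division by
      zero yields 0.\<close>
    moreover have "(-1) ^ Suc n / of_nat n * u ^ n = fps_nth (fps_ln 1) n * u ^ n" for n
      by (cases n) (auto simp: fps_ln_def)
    ultimately show ?case by simp
  qed
qed

lemma psiF_has_fps_expansion:
  "(\<lambda>t. Ln (1 + H/(H-1) * (exp t - 1)) - H/(H-1) * t) has_fps_expansion psiF H"
proof -
  have "((\<lambda>u. Ln (1 + u)) \<circ> (\<lambda>t. H/(H-1) * (exp t - 1))) has_fps_expansion
          fps_compose (fps_ln 1) (fps_const (H/(H-1)) * (fps_exp 1 - 1))"
    by (intro has_fps_expansion_compose has_fps_expansion_Ln1p fps_expansion_intros) auto
  then show ?thesis
    unfolding psiF_def o_def by (intro fps_expansion_intros) 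
qed

lemma cH_power2: "H \<noteq> 0 \<Longrightarrow> (cH H)\<^sup>2 = - (H - 1)\<^sup>2 / H"
  by (simp add: cH_def power_divide power_mult_distrib)

text \<open>The linear term cancels because z = H/(H-1) is exactly the saddle point condition. The
  quadratic term is the origin of c: comparing t^2/(2 c^2) with w^2/2 gives t = c w to first order,
  up to sign.\<close>

lemma psiF_nth:
  assumes "H \<noteq> 0" "H \<noteq> 1"
  shows "fps_nth (psiF H) 0 = 0" "fps_nth (psiF H) 1 = 0"
        "fps_nth (psiF H) 2 = 1 / (2 * (cH H)\<^sup>2)"
proof -
  show "fps_nth (psiF H) 0 = 0" by (simp add: psiF_def fps_ln_def)
  show "fps_nth (psiF H) 1 = 0" by (simp add: psiF_def fps_ln_def fps_compose_nth)
  show "fps_nth (psiF H) 2 = 1 / (2 * (cH H)\<^sup>2)"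
  proof -
    define z where "z = H / (H - 1)"
    have "fps_nth (psiF H) 2 = z / 2 - z\<^sup>2 / 2"
      by (simp add: psiF_def fps_ln_def fps_compose_nth numeral_2_eq_2 fps_mult_nth
          power2_eq_square flip: z_def)
    also have "\<dots> = 1 / (2 * (cH H)\<^sup>2)"
      unfolding cH_power2[OF assms(1)] z_def using assms
      by (simp add: divide_simps) (simp add: power2_eq_square algebra_simps)
    finally show ?thesis .
  qed
qed

text \<open>The phase has a double zero at 0, so after division by t^2 it is analytic and nonzero
  there and has an analytic square root.\<close>

lemma saddle_coordinate_exists:
  assumes "H \<noteq> 0" "H \<noteq> 1"
  obtains W where "W analytic_on {0}" "W 0 = 0" "deriv W 0 = 1 / cH H"
    "\<forall>\<^sub>F t in nhds 0. (W t)\<^sup>2 = 2 * (Ln (1 + H/(H-1) * (exp t - 1)) - H/(H-1) * t)"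
proof -
  define c where "c = cH H"
  have c0: "c \<noteq> 0" using assms by (auto simp: c_def cH_def)
  define \<phi> where "\<phi> = (\<lambda>t. Ln (1 + H/(H-1) * (exp t - 1)) - H/(H-1) * t)"
  define g where "g = (\<lambda>t. if t = 0 then fps_nth (psiF H) 2 else \<phi> t / t ^ 2)"
  have n2: "fps_nth (psiF H) 2 = 1 / (2 * c\<^sup>2)" using psiF_nth[OF assms] by (simp add: c_def)
  have "2 \<le> subdegree (psiF H)"
  proof (rule subdegree_geI)
    show "psiF H \<noteq> 0" using n2 c0 by auto
    fix i :: nat assume "i < 2"
    then show "fps_nth (psiF H) i = 0" using psiF_nth(1,2)[OF assms] by (auto simp: less_2_cases_iff)
  qed
  then have g: "g has_fps_expansion fps_shift 2 (psiF H)"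
    unfolding g_def \<phi>_def by (intro has_fps_expansion_shift psiF_has_fps_expansion) auto
  have g0: "2 * c\<^sup>2 * g 0 = 1" using n2 c0 by (simp add: g_def)
  \<comment> \<open>The factor 2 c^2 puts the argument of \<open>csqrt\<close> at 1 when t = 0, away
    from the branch cut, and selects the sign for which W'(0) = 1/c.\<close>
  define W where "W = (\<lambda>t. t * (1 / c * csqrt (2 * c\<^sup>2 * g t)))"
  have "g analytic_on {0}" using g by (rule has_fps_expansion_imp_analytic_0)
  then have "(\<lambda>t. 2 * c\<^sup>2 * g t) analytic_on {0}" by (intro analytic_intros)
  then have "(csqrt \<circ> (\<lambda>t. 2 * c\<^sup>2 * g t)) analytic_on {0}"
    using g0 by (intro analytic_on_compose_gen[where T = "- \<real>\<^sub>\<le>\<^sub>0"])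
      (auto simp: analytic_on_open open_Compl holomorphic_on_csqrt)
  then have S: "(\<lambda>t. 1 / c * csqrt (2 * c\<^sup>2 * g t)) analytic_on {0}"
    unfolding o_def by (rule analytic_on_mult[OF analytic_on_const])
  then have W: "W analytic_on {0}" unfolding W_def by (rule analytic_on_mult[OF analytic_on_ident])
  have dS: "(\<lambda>t. 1 / c * csqrt (2 * c\<^sup>2 * g t)) field_differentiable at 0"
    using S by (simp add: analytic_on_imp_differentiable_at)
  have "deriv W 0 = 1 / c"
    unfolding W_def using dS g0 by (subst deriv_mult) auto
  moreover have "\<phi> 0 = 0" by (simp add: \<phi>_def)
  then have "(W t)\<^sup>2 = 2 * \<phi> t" for t
    using c0 by (auto simp: W_def g_def power_mult_distrib power_divide)
  ultimately show ?thesis using W by (intro that[of W]) (auto simp: c_def \<phi>_def W_def)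
qed

text \<open>This discharges the definite description in \<open>tser\<close>. Since psiF = V^2/2, the
  defining equation says that V composed with T squares to X^2, so it is X or -X because formal
  series over a field form an integral domain. The prescribed linear coefficient of T excludes
  -X.\<close>

lemma tser_eq_fps_inv:
  assumes "cH H \<noteq> 0" "fps_nth V 0 = 0" "fps_nth V 1 = 1 / cH H" "V\<^sup>2 = 2 * psiF H"
  shows "tser H = fps_inv V"
  unfolding tser_def
proof (rule the_equality)
  let ?c = "cH H"
  have V1: "fps_nth V 1 \<noteq> 0" using assms by simp
  have inv0: "fps_nth (fps_inv V) 0 = 0" by (simp add: fps_inv_def)
  have VV: "V oo fps_inv V = fps_X" using fps_inv_right[OF assms(2) V1] .
  have half: "psiF H = fps_const (1/2) * V\<^sup>2"
    by (simp add: assms(4) numeral_fps_const fps_eq_iff)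
  have comp: "psiF H oo T = fps_const (1/2) * (V oo T)\<^sup>2" if "fps_nth T 0 = 0" for T
    unfolding half by (simp add: fps_compose_mult_distrib that fps_compose_power)
  have "fps_nth (V oo fps_inv V) 1 = 1" by (simp add: VV)
  then have "fps_nth (fps_inv V) 1 = ?c"
    using assms by (simp add: fps_compose_nth)
  then show "fps_nth (fps_inv V) 0 = 0 \<and> fps_nth (fps_inv V) 1 = ?c \<and>
      psiF H oo fps_inv V = fps_const (1/2) * fps_X\<^sup>2"
    using inv0 comp[OF inv0] VV by simp
  fix T assume T: "fps_nth T 0 = 0 \<and> fps_nth T 1 = ?c \<and> psiF H oo T = fps_const (1/2) * fps_X\<^sup>2"
  then have "fps_const (1/2) * (V oo T)\<^sup>2 = fps_const (1/2) * fps_X\<^sup>2" using comp by metis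
  then have "(V oo T)\<^sup>2 = fps_X\<^sup>2" by simp
  then have "V oo T = fps_X \<or> V oo T = - fps_X" by (simp add: power2_eq_iff)
  moreover have "fps_nth (V oo T) 1 = 1"
    using T assms by (simp add: fps_compose_nth)
  ultimately have VT: "V oo T = fps_X" by auto
  have "fps_inv V oo (V oo T) = fps_inv V oo V oo T"
    using T assms by (intro fps_compose_assoc) auto
  then show "T = fps_inv V" using T VT fps_inv[OF assms(2) V1]
    by (simp add: fps_X_fps_compose_startby0)
qed

lemma has_fps_expansion_imp_bound:
  fixes f :: "complex \<Rightarrow> complex"
  assumes "f has_fps_expansion fps_X ^ M * R"
  obtains C where "\<forall>\<^sub>F t in nhds 0. norm (f t) \<le> C * norm t ^ M"
\<comment> \<open>The zero series has subdegree 0 by convention, so division by t^M through a shift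
  is only available when R is nonzero.\<close>
proof (cases "R = 0")
  case True
  with assms have "\<forall>\<^sub>F t in nhds 0. f t = 0" by (simp add: has_fps_expansion_0_iff)
  then show ?thesis by (intro that[of 0]) (auto elim: eventually_mono)
next
  case False
  let ?F = "fps_X ^ M * R"
  let ?h = "\<lambda>t. if t = 0 then fps_nth ?F M else f t / t ^ M"
  have "?h has_fps_expansion fps_shift M ?F"
    using assms False by (intro has_fps_expansion_shift) auto
  then have "(?h \<longlongrightarrow> fps_nth (fps_shift M ?F) 0) (nhds 0)"
    by (rule has_fps_expansion_imp_tendsto_0)
  then have "\<forall>\<^sub>F t in nhds 0. dist (?h t) (fps_nth (fps_shift M ?F) 0) < 1"
    by (rule tendstoD) simp
  moreover have "\<forall>\<^sub>F t in nhds 0. f t = eval_fps ?F t"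
    using assms by (auto simp: has_fps_expansion_def eq_commute)
  ultimately have "\<forall>\<^sub>F t in nhds 0. norm (f t) \<le> (norm (fps_nth R 0) + 1) * norm t ^ M"
  proof eventually_elim
    case (elim t)
    show ?case
    proof (cases "t = 0")
      case True
      with elim show ?thesis
        by (cases M) (auto simp: eval_fps_at_0 fps_X_power_mult_nth)
    next
      case False
      then have "dist (f t / t ^ M) (fps_nth R 0) < 1"
        using elim by (simp add: fps_X_power_mult_nth)
      then have "norm (f t / t ^ M) \<le> norm (fps_nth R 0) + 1"
        unfolding dist_norm by norm
      then show ?thesis using False by (simp add: norm_divide norm_power divide_simps)
    qed
  qed
  then show ?thesis by (rule that)
qed

text \<open>With T = \<open>tser H\<close> and V the Taylor series of W, T composed with V is X, so
  by the chain rule (G oo V) V' = (T oo V)'/(lam + T oo V) = 1/(lam + X). Cutting G at degree M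
  leaves a multiple of V^M, which is divisible by X^M because V has no constant term.\<close>

lemma amplitude_expansion:
  assumes H: "H \<noteq> 0" "H \<noteq> 1" and lam: "lam \<noteq> 0"
  assumes W: "W analytic_on {0}" "W 0 = 0" "deriv W 0 = 1 / cH H"
    "\<forall>\<^sub>F t in nhds 0. (W t)\<^sup>2 = 2 * (Ln (1 + H/(H-1) * (exp t - 1)) - H/(H-1) * t)"
  defines "G \<equiv> fps_deriv (tser H) * inverse (fps_const lam + tser H)"
  obtains C where "\<forall>\<^sub>F t in nhds 0.
    norm (1 / (lam + t) - (\<Sum>m<M. fps_nth G m * W t ^ m) * deriv W t) \<le> C * norm t ^ M"
proof -
  define V where "V = fps_expansion W 0"
  have V: "W has_fps_expansion V" unfolding V_def using W(1) by (rule analytic_at_imp_has_fps_expansion_0)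
  have c: "cH H \<noteq> 0" using H by (simp add: cH_def)
  have V0: "fps_nth V 0 = 0" and V1: "fps_nth V 1 = 1 / cH H"
    using fps_nth_fps_expansion[OF V] W by simp_all
  have "(\<lambda>t. (W t)\<^sup>2) has_fps_expansion V\<^sup>2" using V by (intro fps_expansion_intros)
  also have "?this \<longleftrightarrow> (\<lambda>t. 2 * (Ln (1 + H/(H-1) * (exp t - 1)) - H/(H-1) * t)) has_fps_expansion V\<^sup>2"
    using W(4) by (rule has_fps_expansion_cong) simp
  finally have "V\<^sup>2 = 2 * psiF H"
    by (rule fps_expansion_unique_complex) (intro fps_expansion_intros psiF_has_fps_expansion)
  with c V0 V1 have T: "tser H = fps_inv V" by (intro tser_eq_fps_inv)
  have V1': "fps_nth V 1 \<noteq> 0" using V1 c by simp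
  have TV: "tser H oo V = fps_X" unfolding T using V0 V1' by (rule fps_inv)
  have T0: "fps_nth (tser H) 0 = 0" by (simp add: T fps_inv_def)
  have "(G oo V) * fps_deriv V = (fps_deriv (tser H) oo V) * fps_deriv V * (inverse (fps_const lam + tser H) oo V)"
    by (simp add: G_def fps_compose_mult_distrib V0 mult_ac)
  also have "(fps_deriv (tser H) oo V) * fps_deriv V = fps_deriv (tser H oo V)"
    using V0 by (rule fps_compose_deriv[symmetric])
  also have "\<dots> = 1" by (simp add: TV)
  also have "inverse (fps_const lam + tser H) oo V = inverse ((fps_const lam + tser H) oo V)"
    using V0 T0 lam by (intro fps_inverse_compose) auto
  also have "\<dots> = inverse (fps_const lam + fps_X)" by (simp add: fps_compose_add_distrib TV)
  finally have GV: "(G oo V) * fps_deriv V = inverse (fps_const lam + fps_X)" by simp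
  define P where "P = (\<Sum>m<M. fps_const (fps_nth G m) * fps_X ^ m)"
  have PG: "G = P + fps_X ^ M * fps_shift M G"
    by (rule fps_ext) (auto simp: P_def fps_sum_nth fps_X_power_mult_nth if_distrib cong: if_cong)
  have PV: "P oo V = (\<Sum>m<M. fps_const (fps_nth G m) * V ^ m)"
    by (simp add: P_def fps_compose_sum_distrib fps_compose_mult_distrib V0 flip: fps_compose_power)
  have VX: "V = fps_X * fps_shift 1 V"
    by (rule fps_ext) (auto simp: V0)
  have "G oo V = (P oo V) + V ^ M * (fps_shift M G oo V)"
    by (subst PG) (simp add: fps_compose_add_distrib fps_compose_mult_distrib V0 flip: fps_compose_power)
  then have "inverse (fps_const lam + fps_X) - (P oo V) * fps_deriv V = V ^ M * ((fps_shift M G oo V) * fps_deriv V)"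
    unfolding GV[symmetric] by (simp add: algebra_simps)
  also have "\<dots> = fps_X ^ M * (fps_shift 1 V ^ M * ((fps_shift M G oo V) * fps_deriv V))"
    by (subst VX) (simp add: power_mult_distrib mult_ac)
  finally have eq: "inverse (fps_const lam + fps_X) - (P oo V) * fps_deriv V = \<dots>" .
  have "(\<lambda>t. inverse (lam + t) - (\<Sum>m<M. fps_nth G m * W t ^ m) * deriv W t) has_fps_expansion
      inverse (fps_const lam + fps_X) - (P oo V) * fps_deriv V"
    unfolding PV using V lam by (intro fps_expansion_intros) auto
  then show ?thesis unfolding eq
    by (rule has_fps_expansion_imp_bound) (use that in \<open>simp add: divide_inverse\<close>)
qed

section \<open>From Gaussian moments to the coefficients of the expansion\<close>

lemma sum_even_lessThan:
  "(\<Sum>m<2*N. if even m then g (m div 2) else 0) = (\<Sum>k<N. g k)" for g :: "nat \<Rightarrow> 'a::comm_monoid_add"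
  by (induction N) auto

text \<open>The factor 2^k (1/2)_k of the expansion is the double factorial (2k-1)!! = (2k)!/(2^k
  k!) of the Gaussian moment.\<close>

lemma gauss_moment_even_pochhammer:
  "gauss_moment (2 * k) a = sqrt (2 * pi / a) * (2 ^ k * pochhammer (1/2) k / a ^ k)"
proof -
  have "fact (2 * k) / (2 ^ k * fact k) = (2 ^ k * pochhammer (1/2) k :: real)"
    unfolding fact_double by (simp add: mult_2 power_add)
  then show ?thesis by (simp add: gauss_moment_def)
qed

text \<open>Odd moments vanish, so only the coefficients of even index 2k survive. They differ from
  \<open>A_coeff\<close> by c/lam, the constant term that was divided out to make A_0 = 1.\<close>

lemma sum_gauss_moment_A_coeff:
  assumes "cH H \<noteq> 0" "lam \<noteq> 0"
  shows "(\<Sum>m<2*N. fps_nth (fps_deriv (tser H) * inverse (fps_const lam + tser H)) m * of_real (gauss_moment m a))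
    = cH H / lam * of_real (sqrt (2 * pi / a)) * (\<Sum>k<N. of_real (2 ^ k * pochhammer (1/2) k / a ^ k) * A_coeff k H lam)"
proof -
  let ?G = "fps_deriv (tser H) * inverse (fps_const lam + tser H)"
  have A: "fps_nth ?G (2 * k) = cH H / lam * A_coeff k H lam" for k
    using assms by (simp add: A_coeff_def mult.assoc)
  have "(\<Sum>m<2*N. fps_nth ?G m * of_real (gauss_moment m a)) =
     (\<Sum>m<2*N. if even m then fps_nth ?G (2 * (m div 2)) * of_real (gauss_moment (2 * (m div 2)) a) else 0)"
    by (intro sum.cong refl) (auto simp: gauss_moment_def)
  also have "\<dots> = (\<Sum>k<N. fps_nth ?G (2 * k) * of_real (gauss_moment (2 * k) a))"
    by (rule sum_even_lessThan)
  also have "\<dots> = cH H / lam * of_real (sqrt (2 * pi / a)) * (\<Sum>k<N. of_real (2 ^ k * pochhammer (1/2) k / a ^ k) * A_coeff k H lam)"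
    unfolding A gauss_moment_even_pochhammer sum_distrib_left by (intro sum.cong refl) (simp add: mult_ac)
  finally show ?thesis .
qed

section \<open>The contour integral\<close>

text \<open>A weak Jordan inequality with a constant that is not sharp. Up to pi/3 the derivative
  cos y - 1/4 is positive; beyond, sin y >= 1/2 while y/4 stays below 1/2.\<close>

lemma sin_ge_quarter:
  fixes y :: real
  assumes "0 \<le> y" "y \<le> pi / 2"
  shows "y / 4 \<le> sin y"
proof (cases "y \<le> pi / 3")
  case True
  have "sin 0 - 0 / 4 \<le> sin y - y / 4"
  proof (rule DERIV_nonneg_imp_nondecreasing[OF assms(1), where f = "\<lambda>y. sin y - y / 4"])
    fix z assume z: "0 \<le> z" "z \<le> y"
    have "cos (pi / 3) \<le> cos z" using z True pi_gt_zero by (intro cos_monotone_0_pi_le) auto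
    then have "0 \<le> cos z - 1 / 4" by (simp add: cos_60)
    moreover have "((\<lambda>y. sin y - y / 4) has_real_derivative cos z - 1 / 4) (at z)"
      by (auto intro!: derivative_eq_intros)
    ultimately show "\<exists>d. ((\<lambda>y. sin y - y / 4) has_real_derivative d) (at z) \<and> 0 \<le> d" by blast
  qed
  then show ?thesis by simp
next
  case False
  then have "sin (pi / 6) \<le> sin y" using assms pi_gt_zero by (intro sin_monotone_2pi_le) auto
  moreover have "y / 4 \<le> 1 / 2" using assms(2) pi_less_4 by linarith
  ultimately show ?thesis by (simp add: sin_30)
qed

text \<open>The half-angle formula turns the sine bound into 2 (|y|/8)^2.\<close>

lemma one_minus_cos_ge:
  fixes y :: real
  assumes "\<bar>y\<bar> \<le> pi"
  shows "y\<^sup>2 / 32 \<le> 1 - cos y"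
proof -
  have "\<bar>y\<bar> / 2 / 4 \<le> sin (\<bar>y\<bar> / 2)" using assms by (intro sin_ge_quarter) auto
  then have "(\<bar>y\<bar> / 2 / 4)\<^sup>2 \<le> (sin (\<bar>y\<bar> / 2))\<^sup>2" by (intro power_mono) auto
  moreover have "cos y = 1 - 2 * (sin (\<bar>y\<bar> / 2))\<^sup>2"
    using cos_double_sin[of "\<bar>y\<bar> / 2"] by simp
  ultimately show ?thesis by (simp add: power_divide)
qed

text \<open>The function bounded here is u(s_0 + i \<theta>)/u(s_0) with h = exp s_0. Its numerator
  has constant modulus because x is real, and |h e^(i \<theta>) - 1|^2 = (h-1)^2 + 2h (1 - cos
  \<theta>) is smallest at \<theta> = 0, so the saddle is the only maximum on the whole
  side.\<close>

lemma norm_phase_le_gaussian: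
  fixes h x :: real
  assumes "h > 1"
  obtains \<kappa> where "\<kappa> > 0" "\<And>\<theta>. \<bar>\<theta>\<bar> \<le> pi \<Longrightarrow>
    norm (exp (of_real x * (\<i> * of_real \<theta>)) * of_real (h - 1) / (of_real h * exp (\<i> * of_real \<theta>) - 1)) \<le> exp (- \<kappa> * \<theta>\<^sup>2)"
proof -
  define \<rho> where "\<rho> = 2 * h / (h - 1)\<^sup>2 / 32"
  have \<rho>: "\<rho> > 0" using assms by (simp add: \<rho>_def)
  \<comment> \<open>This is the rate for the squared modulus, with \<theta>^2 replaced by pi^2 in
    the denominator of \<rho> \<theta>^2/(1 + \<rho> \<theta>^2). Taking the square root halves
    it.\<close>
  define k where "k = \<rho> / (1 + \<rho> * pi\<^sup>2)"
  have k: "k > 0" using \<rho> by (simp add: k_def add_pos_pos)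
  show ?thesis
  proof (rule that)
    show "k / 2 > 0" using k by simp
    fix \<theta> :: real assume \<theta>: "\<bar>\<theta>\<bar> \<le> pi"
    define q where "q = exp (of_real x * (\<i> * of_real \<theta>)) * of_real (h - 1) / (of_real h * exp (\<i> * of_real \<theta>) - 1)"
    have "(norm (of_real h * exp (\<i> * of_real \<theta>) - 1))\<^sup>2 = (h * cos \<theta> - 1)\<^sup>2 + (h * sin \<theta>)\<^sup>2"
      by (simp add: cmod_power2 Re_exp Im_exp)
    also have "\<dots> = (h - 1)\<^sup>2 + 2 * h * (1 - cos \<theta>)"
      unfolding power_mult_distrib sin_squared_eq by (simp add: power2_eq_square algebra_simps)
    also have "\<dots> \<ge> (h - 1)\<^sup>2 + 2 * h * (\<theta>\<^sup>2 / 32)"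
      using one_minus_cos_ge[OF \<theta>] assms by (intro add_left_mono mult_left_mono) auto
    also have "(h - 1)\<^sup>2 + 2 * h * (\<theta>\<^sup>2 / 32) = (h - 1)\<^sup>2 * (1 + \<rho> * \<theta>\<^sup>2)"
      using assms by (simp add: \<rho>_def distrib_left)
    finally have den: "(norm (of_real h * exp (\<i> * of_real \<theta>) - 1))\<^sup>2 \<ge> (h - 1)\<^sup>2 * (1 + \<rho> * \<theta>\<^sup>2)" .
    have pos: "1 + \<rho> * \<theta>\<^sup>2 > 0" using \<rho> by (simp add: add_pos_nonneg)
    have "norm (exp (of_real x * (\<i> * of_real \<theta>))) = 1"
      by (simp add: norm_exp_eq_Re)
    then have "(norm q)\<^sup>2 = (h - 1)\<^sup>2 / (norm (of_real h * exp (\<i> * of_real \<theta>) - 1))\<^sup>2"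
      unfolding q_def norm_divide norm_mult norm_of_real power_divide by simp
    also have "\<dots> \<le> (h - 1)\<^sup>2 / ((h - 1)\<^sup>2 * (1 + \<rho> * \<theta>\<^sup>2))"
    proof -
      have dp: "(h - 1)\<^sup>2 * (1 + \<rho> * \<theta>\<^sup>2) > 0" using pos assms by (intro mult_pos_pos) auto
      show ?thesis
        by (rule divide_left_mono[OF den _ mult_pos_pos[OF less_le_trans[OF dp den] dp]]) simp
    qed
    \<comment> \<open>Writing 1/(1+y) as 1 - y/(1+y) makes the inequality 1 - v <= exp(-v)
      applicable, which turns the rational bound into an exponential one.\<close>
    also have "\<dots> = 1 - \<rho> * \<theta>\<^sup>2 / (1 + \<rho> * \<theta>\<^sup>2)"
    proof -
      have "1 - \<rho> * \<theta>\<^sup>2 / (1 + \<rho> * \<theta>\<^sup>2) = 1 / (1 + \<rho> * \<theta>\<^sup>2)"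
        using pos by (simp add: divide_simps)
      then show ?thesis using assms by simp
    qed
    also have "\<dots> \<le> exp (- (\<rho> * \<theta>\<^sup>2 / (1 + \<rho> * \<theta>\<^sup>2)))"
      using exp_ge_add_one_self[of "- (\<rho> * \<theta>\<^sup>2 / (1 + \<rho> * \<theta>\<^sup>2))"] by simp
    also have "\<dots> \<le> exp (- (k * \<theta>\<^sup>2))"
    proof -
      have "\<theta>\<^sup>2 \<le> pi\<^sup>2" using \<theta> by (simp add: abs_le_square_iff[symmetric])
      then have "\<rho> * \<theta>\<^sup>2 / (1 + \<rho> * pi\<^sup>2) \<le> \<rho> * \<theta>\<^sup>2 / (1 + \<rho> * \<theta>\<^sup>2)"
        using \<rho> pos by (intro divide_left_mono) (auto intro!: mult_left_mono mult_pos_pos add_pos_pos)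
      then show ?thesis by (simp add: k_def)
    qed
    also have "\<dots> = (exp (- (k / 2) * \<theta>\<^sup>2))\<^sup>2" by (simp add: power2_eq_square exp_add[symmetric])
    finally have "norm q \<le> exp (- (k / 2) * \<theta>\<^sup>2)" by (rule power2_le_imp_le) simp
    then show "norm (exp (of_real x * (\<i> * of_real \<theta>)) * of_real (h - 1) / (of_real h * exp (\<i> * of_real \<theta>) - 1)) \<le> exp (- (k / 2) * \<theta>\<^sup>2)"
      by (simp only: q_def)
  qed
qed

section \<open>Transfer from real formal series to a complex residue\<close>

definition fps_of_real :: "real fps \<Rightarrow> complex fps" where
  "fps_of_real F = Abs_fps (\<lambda>n. of_real (fps_nth F n))"

lemma fps_of_real_nth [simp]: "fps_nth (fps_of_real F) n = of_real (fps_nth F n)"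
  by (simp add: fps_of_real_def)

lemma fps_of_real_1 [simp]: "fps_of_real 1 = 1"
  by (rule fps_ext) simp

lemma fps_of_real_mult: "fps_of_real (F * G) = fps_of_real F * fps_of_real G"
  by (rule fps_ext) (simp add: fps_mult_nth)

lemma fps_of_real_power: "fps_of_real (F ^ n) = fps_of_real F ^ n"
  by (induction n) (simp_all add: fps_of_real_mult)

lemma fps_of_real_inverse:
  assumes "fps_nth F 0 \<noteq> 0"
  shows "fps_of_real (inverse F) = inverse (fps_of_real F)"
proof -
  have "fps_of_real F * fps_of_real (inverse F) = 1"
    using inverse_mult_eq_1'[OF assms] by (simp flip: fps_of_real_mult)
  then show ?thesis by (rule fps_inverse_unique[symmetric])
qed

lemma of_real_gen_bernoulli:
  "complex_of_real (gen_bernoulli n mu z) =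
     fact n * fps_nth ((inverse (fps_shift 1 (fps_exp 1 - 1))) ^ mu * fps_exp (of_real z)) n"
proof -
  have shift: "fps_of_real (fps_shift 1 (fps_exp 1 - 1)) = fps_shift 1 (fps_exp 1 - 1)"
    by (rule fps_ext) simp
  have exp: "fps_of_real (fps_exp z) = fps_exp (of_real z)"
    by (rule fps_ext) simp
  have "fps_of_real ((inverse (fps_shift 1 (fps_exp 1 - 1))) ^ mu * fps_exp z) =
    (inverse (fps_shift 1 (fps_exp 1 - 1))) ^ mu * fps_exp (of_real z)"
    unfolding fps_of_real_mult fps_of_real_power exp
    by (subst fps_of_real_inverse) (simp, simp only: shift)
  then show ?thesis
    unfolding gen_bernoulli_def by (metis fps_of_real_nth of_real_fact of_real_mult)
qed

text \<open>The n-th coefficient of (t/(e^t-1))^n e^(zt) is the residue after division by t^(n+1).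
  Since the order of the polynomial equals its degree, the factors t^n cancel and a single 1/t is
  left, which for z = n x gives the n-th power of a fixed function.\<close>

lemma gen_bernoulli_residue:
  "complex_of_real (gen_bernoulli n n z) =
     fact n * residue (\<lambda>t. exp (of_real z * t) / ((exp t - 1) ^ n * t)) 0"
proof -
  let ?E = "fps_exp 1 - 1 :: complex fps"
  let ?e = "\<lambda>t::complex. if t = 0 then fps_nth ?E 1 else (exp t - 1) / t ^ 1"
  have "fps_nth ?E 1 = 1" by simp
  \<comment> \<open>A nonzero series with no constant term has subdegree at least 1, as dividing e^t
    - 1 by t requires.\<close>
  then have nz: "?E \<noteq> 0" by (metis fps_zero_nth zero_neq_one)
  have e: "?e has_fps_expansion fps_shift 1 ?E"
    using nz by (intro has_fps_expansion_shift fps_expansion_intros) (auto intro!: subdegree_geI)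
  have *: "(\<lambda>t. inverse (?e t) ^ n * exp (of_real z * t)) has_fps_expansion
     (inverse (fps_shift 1 ?E)) ^ n * fps_exp (of_real z)"
    by (intro fps_expansion_intros e) auto
  have "residue (\<lambda>t. exp (of_real z * t) / ((exp t - 1) ^ n * t)) 0 =
        residue (\<lambda>t. inverse (?e t) ^ n * exp (of_real z * t) / t ^ Suc n) 0"
  proof (rule residue_cong)
    show "\<forall>\<^sub>F t in at 0. exp (of_real z * t) / ((exp t - 1) ^ n * t) =
        inverse (?e t) ^ n * exp (of_real z * t) / t ^ Suc n"
      by (intro eventually_at_filter[THEN iffD2] always_eventually allI impI)
        (simp add: power_divide divide_simps)
  qed simp
  also have "\<dots> = fps_nth ((inverse (fps_shift 1 ?E)) ^ n * fps_exp (of_real z)) n"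
    by (rule residue_fps_expansion_over_power_at_0[OF *])
  finally show ?thesis by (simp add: of_real_gen_bernoulli)
qed

section \<open>The rectangle and its three subordinate sides\<close>

lemma exp_neq_1_strip:
  fixes t :: complex
  assumes "\<bar>Im t\<bar> < 2 * pi" "t \<noteq> 0"
  shows "exp t \<noteq> 1"
proof
  assume "exp t = 1"
  then obtain k :: int where k: "Re t = 0" "Im t = of_int (2 * k) * pi" by (auto simp: exp_eq_1)
  then have "\<bar>of_int k :: real\<bar> < 1" using assms(1) by (simp add: abs_mult)
  then have "k = 0" by linarith
  with k assms(2) show False by (simp add: complex_eq_iff)
qed

text \<open>At height pi the exponential is negative, so the modulus of the denominator is e^(Re t)
  + 1. The quotient becomes e^((x-1) Re t)/(1 + e^(-Re t)), increasing in Re t as x > 1, and at Re t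
  = s the plus sign still makes it strictly smaller than u(s).\<close>

lemma norm_exp_div_exp_minus_1_horizontal:
  fixes t :: complex
  assumes "x > 1" "\<bar>Im t\<bar> = pi" "Re t \<le> s" "s > 0"
  shows "norm (exp (of_real x * t) / (exp t - 1)) < exp (x * s) / (exp s - 1)"
proof -
  have "exp t = - of_real (exp (Re t))"
  proof -
    have "cos (Im t) = - 1" "sin (Im t) = 0"
      using assms(2) by (auto simp: abs_if split: if_splits) (metis cos_minus cos_pi minus_minus, metis sin_minus sin_pi minus_minus neg_0_equal_iff_equal)+
    then show ?thesis by (simp add: complex_eq_iff Re_exp Im_exp)
  qed
  then have "exp t - 1 = - of_real (exp (Re t) + 1)" by simp
  then have "norm (exp t - 1) = exp (Re t) + 1"
    by (simp only: norm_minus_cancel norm_of_real) (simp add: add_pos_pos)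
  then have "norm (exp (of_real x * t) / (exp t - 1)) = exp (x * Re t) / (exp (Re t) + 1)"
    by (simp add: norm_divide)
  also have "\<dots> = exp ((x - 1) * Re t) / (1 + exp (- Re t))"
  proof -
    have "exp (x * Re t) = exp ((x - 1) * Re t) * exp (Re t)"
      unfolding exp_add[symmetric] by (simp add: algebra_simps)
    moreover have "exp (Re t) + 1 = (1 + exp (- Re t)) * exp (Re t)"
      by (simp add: algebra_simps exp_add[symmetric])
    ultimately show ?thesis by simp
  qed
  also have "\<dots> \<le> exp ((x - 1) * s) / (1 + exp (- s))"
    using assms by (intro frac_le) (auto intro: add_pos_pos mult_left_mono)
  also have "\<dots> < exp ((x - 1) * s) / (1 - exp (- s))"
    using assms by (intro divide_strict_left_mono) (auto intro!: mult_pos_pos add_pos_pos)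
  also have "\<dots> = exp (x * s) / (exp s - 1)"
  proof -
    have "exp (x * s) = exp ((x - 1) * s) * exp s"
      unfolding exp_add[symmetric] by (simp add: algebra_simps)
    moreover have "exp s - 1 = (1 - exp (- s)) * exp s"
      by (simp add: algebra_simps exp_add[symmetric])
    ultimately show ?thesis by simp
  qed
  finally show ?thesis .
qed

lemma norm_exp_div_exp_minus_1_left:
  assumes "x > 1" "Q > 0"
  obtains R where "R > 0" "\<And>t::complex. Re t = - R \<Longrightarrow> norm (exp (of_real x * t) / (exp t - 1)) < Q"
proof -
  \<comment> \<open>R >= 1 keeps |e^t - 1| above 1/2, so that |u| <= 2 e^(-R). The logarithm then
    makes this at most Q/2.\<close>
  define R where "R = max 1 (ln (4 / Q))"
  have R: "R \<ge> 1" "R \<ge> ln (4 / Q)" by (auto simp: R_def)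
  have "exp (- R) \<le> exp (- ln (4 / Q))" using R by simp
  then have eQ: "exp (- R) \<le> Q / 4" using assms by (simp add: exp_minus)
  have e2: "exp (- R) \<le> 1 / 2"
  proof -
    have "1 + 1 \<le> exp R" using exp_ge_add_one_self[of R] R by linarith
    then show ?thesis by (simp add: exp_minus field_simps)
  qed
  show ?thesis
  proof (rule that)
    show "R > 0" using R by simp
    fix t :: complex assume t: "Re t = - R"
    have "norm (exp t) = exp (- R)" using t by simp
    then have "norm (exp t - 1) \<ge> 1 / 2" using norm_triangle_ineq2[of 1 "exp t"] e2
      by (simp add: norm_minus_commute)
    then have "norm (exp (of_real x * t) / (exp t - 1)) \<le> exp (- (x * R)) / (1 / 2)"
      unfolding norm_divide using t by (intro frac_le) auto
    also have "\<dots> \<le> exp (- R) * 2" using assms(1) R by simp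
    also have "\<dots> < Q" using eQ assms(2) by simp
    finally show "norm (exp (of_real x * t) / (exp t - 1)) < Q" .
  qed
qed

lemma contour_integral_vertical:
  assumes "continuous_on (closed_segment (Complex s (- L)) (Complex s L)) f" "L > 0"
  shows "contour_integral (linepath (Complex s (- L)) (Complex s L)) f
       = \<i> * integral {-L..L} (\<lambda>\<theta>. f (of_real s + \<i> * of_real \<theta>))"
proof -
  let ?g = "\<lambda>\<theta>. f (of_real s + \<i> * of_real \<theta>)"
  have "continuous_on {-L..L} ?g"
    by (rule continuous_on_compose2[OF assms(1)])
      (auto intro!: continuous_intros simp: closed_segment_same_Re closed_segment_eq_real_ivl)
  then have "(?g has_integral integral {-L..L} ?g) (cbox (-L) L)"
    by (simp add: integrable_continuous_interval integrable_integral)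
  \<comment> \<open>The map u to 2 L u - L carries the parameter interval [0,1] of
    \<open>linepath\<close> onto [-L,L]. The divisor 2 L is restored by the derivative 2 L i of the
    path.\<close>
  from has_integral_affinity'[OF this, of "2 * L" "-L"]
  have "((\<lambda>u. ?g (2 * L * u + - L)) has_integral integral {-L..L} ?g /\<^sub>R (2 * L))
     (cbox ((- L - - L) /\<^sub>R (2 * L)) ((L - - L) /\<^sub>R (2 * L)))"
    using assms(2) unfolding real_scaleR_def DIM_real power_one_right by linarith
  moreover have "(- L - - L) /\<^sub>R (2 * L) = 0" "(L - - L) /\<^sub>R (2 * L) = 1"
    using assms(2) by (simp_all add: field_simps)
  ultimately have "((\<lambda>u. ?g (2 * L * u + - L)) has_integral integral {-L..L} ?g /\<^sub>R (2 * L)) {0..1}"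
    by (simp only: cbox_interval)
  from has_integral_mult_left[OF this, of "2 * L * \<i>"]
  have "((\<lambda>u. ?g (2 * L * u + - L) * (2 * L * \<i>)) has_integral \<i> * integral {-L..L} ?g) {0..1}"
    using assms(2) by (simp add: scaleR_conv_of_real field_simps)
  moreover have "of_real s + \<i> * of_real (2 * L * u + - L) = linepath (Complex s (- L)) (Complex s L) u" for u
    by (simp add: linepath_def complex_eq_iff algebra_simps)
  moreover have "2 * L * \<i> = Complex s L - Complex s (- L)" by (simp add: complex_eq_iff)
  ultimately show ?thesis
    by (intro contour_integral_unique) (simp add: has_contour_integral_linepath)
qed

text \<open>For n-th powers a pointwise bound |u| < Q is not enough. The three sides form a compact
  set, so |u| attains a maximum B < Q there, and their contribution is geometrically smaller than
  Q^n. Any s > 0 is allowed; the saddle is chosen later.\<close>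

lemma gen_bernoulli_rectangle:
  fixes x s :: real
  assumes x: "x > 1" and s: "s > 0"
  defines "u \<equiv> \<lambda>t::complex. exp (of_real x * t) / (exp t - 1)"
  defines "Q \<equiv> exp (x * s) / (exp s - 1)"
  obtains B K where "0 \<le> B" "B < Q"
    "\<And>n. norm (of_real (gen_bernoulli n n (real n * x)) -
        fact n / (2 * pi) * integral {-pi..pi} (\<lambda>\<theta>. u (of_real s + \<i> * of_real \<theta>) ^ n / (of_real s + \<i> * of_real \<theta>)))
      \<le> fact n * (K * B ^ n)"
proof -
  have Q: "Q > 0" using s by (simp add: Q_def)
  obtain R where R: "R > 0" "\<And>t::complex. Re t = - R \<Longrightarrow> norm (u t) < Q"
    unfolding u_def using norm_exp_div_exp_minus_1_left[OF x Q] by blast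
  define a1 a2 a3 a4 where a: "a1 = Complex (-R) (-pi)" "a2 = Complex s (-pi)" "a3 = Complex s pi" "a4 = Complex (-R) pi"
  define T where "T = closed_segment a1 a2 \<union> closed_segment a3 a4 \<union> closed_segment a4 a1"
  have seg12: "Im t = -pi \<and> Re t \<le> s" if "t \<in> closed_segment a1 a2" for t
    using that R s by (auto simp: a closed_segment_same_Im closed_segment_eq_real_ivl split: if_splits)
  have seg34: "Im t = pi \<and> Re t \<le> s" if "t \<in> closed_segment a3 a4" for t
    using that R s by (auto simp: a closed_segment_same_Im closed_segment_eq_real_ivl split: if_splits)
  have seg41: "Re t = -R \<and> \<bar>Im t\<bar> \<le> pi" if "t \<in> closed_segment a4 a1" for t
    using that by (auto simp: a closed_segment_same_Re closed_segment_eq_real_ivl split: if_splits)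
  have seg23: "Re t = s \<and> \<bar>Im t\<bar> \<le> pi" if "t \<in> closed_segment a2 a3" for t
    using that by (auto simp: a closed_segment_same_Re closed_segment_eq_real_ivl split: if_splits)
  have uQ: "norm (u t) < Q" if "t \<in> T" for t
    using that seg12[of t] seg34[of t] seg41[of t] R(2)[of t] norm_exp_div_exp_minus_1_horizontal[OF x _ _ s, of t]
    unfolding T_def u_def Q_def by auto
  have ne: "t \<noteq> 0 \<and> exp t \<noteq> 1" if "t \<in> T \<or> t \<in> closed_segment a2 a3" for t
  proof -
    have "t \<noteq> 0" "\<bar>Im t\<bar> \<le> pi"
      using that seg12[of t] seg34[of t] seg41[of t] seg23[of t] R(1) s by (auto simp: T_def)
    moreover have "pi < 2 * pi" by simp
    ultimately show ?thesis using exp_neq_1_strip[of t] by linarith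
  qed
  have "compact T" unfolding T_def by (intro compact_Un compact_segment)
  moreover have "a1 \<in> T" by (simp add: T_def)
  moreover have "continuous_on T (\<lambda>t. norm (u t))"
    unfolding u_def using ne by (intro continuous_intros) auto
  ultimately obtain t0 where t0: "t0 \<in> T" "\<And>t. t \<in> T \<Longrightarrow> norm (u t) \<le> norm (u t0)"
    using continuous_attains_sup[of T "\<lambda>t. norm (u t)"] by blast
  define B where "B = norm (u t0)"
  have B: "0 \<le> B" "B < Q" using uQ[OF t0(1)] by (auto simp: B_def)
  \<comment> \<open>The three sides keep this distance from the pole at 0, which bounds the factor
    1/t.\<close>
  define d where "d = min R pi"
  have d: "d > 0" using R(1) by (simp add: d_def)
  have dT: "d \<le> norm t" if "t \<in> T" for t
  proof -
    have "R \<le> \<bar>Re t\<bar> \<or> pi \<le> \<bar>Im t\<bar>"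
      using that seg12[of t] seg34[of t] seg41[of t] by (auto simp: T_def)
    then show ?thesis using abs_Re_le_cmod[of t] abs_Im_le_cmod[of t] by (auto simp: d_def)
  qed
  define K where "K = (norm (a2 - a1) + norm (a4 - a3) + norm (a1 - a4)) / (2 * pi * d)"
  have "norm (of_real (gen_bernoulli n n (real n * x)) -
        fact n / (2 * pi) * integral {-pi..pi} (\<lambda>\<theta>. u (of_real s + \<i> * of_real \<theta>) ^ n / (of_real s + \<i> * of_real \<theta>)))
      \<le> fact n * (K * B ^ n)" for n
  proof -
    define f where "f = (\<lambda>t. u t ^ n / t)"
    have f_eq: "f t = exp (of_real (real n * x) * t) / ((exp t - 1) ^ n * t)" for t
      by (simp add: f_def u_def power_divide exp_of_nat_mult[symmetric] mult.assoc)
    have cont: "continuous_on S f" if "S \<subseteq> T \<or> S \<subseteq> closed_segment a2 a3" for S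
      unfolding f_def u_def using ne that by (intro continuous_intros) auto
    have sub: "closed_segment a1 a2 \<subseteq> T" "closed_segment a3 a4 \<subseteq> T" "closed_segment a4 a1 \<subseteq> T"
      by (auto simp: T_def)
    have int: "f contour_integrable_on linepath a1 a2" "f contour_integrable_on linepath a2 a3"
       "f contour_integrable_on linepath a3 a4" "f contour_integrable_on linepath a4 a1"
      using sub by (auto intro!: contour_integrable_continuous_linepath cont)
    have bd: "norm (f t) \<le> B ^ n / d" if "t \<in> T" for t
      unfolding f_def norm_divide norm_power using t0(2)[OF that] dT[OF that] d
      by (intro frac_le power_mono) (auto simp: B_def)
    have side: "norm (contour_integral (linepath a b) f) \<le> B ^ n / d * norm (b - a)"
      if "closed_segment a b \<subseteq> T" for a b
      using that B(1) d by (intro contour_integral_bound_linepath bd contour_integrable_continuous_linepath cont) auto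
    have rect: "rectpath a1 a3 = linepath a1 a2 +++ linepath a2 a3 +++ linepath a3 a4 +++ linepath a4 a1"
      by (simp add: rectpath_def Let_def a)
    \<comment> \<open>A convex open strip around the rectangle that stops short of the zeros of e^t
      - 1 at 2 pi i and -2 pi i, so 0 is the only singularity in it.\<close>
    define S where "S = {t::complex. \<bar>Im t\<bar> < 2 * pi}"
    have S: "S = {t. Im t < 2 * pi} \<inter> {t. Im t > - (2 * pi)}" by (auto simp: S_def)
    have box: "cbox a1 a3 \<subseteq> S"
    proof
      fix t assume "t \<in> cbox a1 a3"
      then have "\<bar>Im t\<bar> \<le> pi" by (auto simp: in_cbox_complex_iff a)
      moreover have "pi < 2 * pi" by simp
      ultimately show "t \<in> S" unfolding S_def by (simp del: pi_gt_zero)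
    qed
    have a_le: "Re a1 \<le> Re a3" "Im a1 \<le> Im a3" using R s by (auto simp: a)
    have img: "path_image (rectpath a1 a3) = closed_segment a1 a2 \<union> closed_segment a2 a3 \<union> closed_segment a3 a4 \<union> closed_segment a4 a1"
      unfolding rect by (simp add: path_image_join Un_assoc)
    have "contour_integral (rectpath a1 a3) f = 2 * pi * \<i> * (\<Sum>p\<in>{0}. winding_number (rectpath a1 a3) p * residue f p)"
    proof (rule Residue_theorem)
      show "open S" unfolding S by (intro open_Int open_halfspace_Im_lt open_halfspace_Im_gt)
      show "connected S" unfolding S
        by (intro convex_connected convex_Int convex_halfspace_Im_lt convex_halfspace_Im_gt)
      show "f holomorphic_on S - {0}"
        unfolding f_def u_def using exp_neq_1_strip by (intro holomorphic_intros) (auto simp: S_def)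
      show "path_image (rectpath a1 a3) \<subseteq> S - {0}"
        using path_image_rectpath_subset_cbox[OF a_le] box ne unfolding img T_def by blast
      show "\<forall>z. z \<notin> S \<longrightarrow> winding_number (rectpath a1 a3) z = 0"
        using box winding_number_rectpath_outside[OF a_le] by blast
    qed auto
    also have "\<dots> = 2 * pi * \<i> * residue f 0"
    proof -
      have "0 \<in> box a1 a3" using R(1) s by (simp add: in_box_complex_iff a)
      then show ?thesis by (simp add: winding_number_rectpath)
    qed
    finally have res: "contour_integral (rectpath a1 a3) f = 2 * pi * \<i> * residue f 0" .
    have "residue f 0 = residue (\<lambda>t. exp (of_real (real n * x) * t) / ((exp t - 1) ^ n * t)) 0"
      by (rule arg_cong[where f = "\<lambda>g. residue g 0"]) (rule ext, rule f_eq)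
    then have gb: "of_real (gen_bernoulli n n (real n * x)) = fact n * residue f 0"
      by (simp only: gen_bernoulli_residue)
    define J where "J = integral {-pi..pi} (\<lambda>\<theta>. f (of_real s + \<i> * of_real \<theta>))"
    have J: "contour_integral (linepath a2 a3) f = \<i> * J"
      unfolding a J_def by (rule contour_integral_vertical) (use cont in \<open>auto simp: a\<close>)
    define E where "E = contour_integral (linepath a1 a2) f + contour_integral (linepath a3 a4) f + contour_integral (linepath a4 a1) f"
    have "contour_integral (rectpath a1 a3) f = E + \<i> * J"
      unfolding rect E_def J[symmetric] using int by simp
    with res have "E = 2 * pi * \<i> * residue f 0 - \<i> * J" by (simp add: eq_diff_eq)
    then have r: "residue f 0 - J / (2 * pi) = E / (2 * pi * \<i>)"
      by (simp add: diff_divide_distrib)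
    have "of_real (gen_bernoulli n n (real n * x)) - fact n / (2 * pi) * J = fact n * (residue f 0 - J / (2 * pi))"
      unfolding gb by (simp add: right_diff_distrib)
    then have norm_eq: "norm (of_real (gen_bernoulli n n (real n * x)) - fact n / (2 * pi) * J) = fact n * (norm E / (2 * pi))"
      unfolding r by (simp add: norm_mult norm_divide)
    have "norm E \<le> B ^ n / d * norm (a2 - a1) + B ^ n / d * norm (a4 - a3) + B ^ n / d * norm (a1 - a4)"
      unfolding E_def by (intro norm_triangle_mono side sub)
    also have "\<dots> = K * B ^ n * (2 * pi)"
      using d by (simp add: K_def field_simps)
    finally have "norm E / (2 * pi) \<le> K * B ^ n" by (simp add: pos_divide_le_eq)
    then have "fact n * (norm E / (2 * pi)) \<le> fact n * (K * B ^ n)" by (intro mult_left_mono) auto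
    then show ?thesis unfolding norm_eq[symmetric] J_def f_def .
  qed
  with B show ?thesis by (rule that)
qed

section \<open>Asymptotic expansion\<close>

lemma geometric_decay_bigo:
  fixes B Q :: real
  assumes "0 \<le> B" "B < Q"
  shows "(\<lambda>n::nat. B ^ n) \<in> O(\<lambda>n. Q ^ n * (1 / (real n ^ N * sqrt (real n))))"
proof -
  \<comment> \<open>The possible value B = 0 is raised to a positive base still below Q, so that the
    decay rate can be written as a logarithm.\<close>
  define b where "b = max B (Q / 2)"
  have b: "0 < b" "b < Q" "B \<le> b" using assms by (auto simp: b_def)
  define \<rho> where "\<rho> = ln (Q / b)"
  have \<rho>: "\<rho> > 0" using b by (simp add: \<rho>_def)
  have eq: "b ^ n = Q ^ n * exp (- \<rho> * real n)" for n
  proof -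
    have "exp (- \<rho>) = b / Q" using b by (simp add: \<rho>_def exp_minus)
    then have "exp (- \<rho> * real n) = (b / Q) ^ n"
      by (metis exp_of_nat_mult mult.commute)
    then show ?thesis using b by (simp add: power_divide)
  qed
  have "(\<lambda>n::nat. B ^ n) \<in> O(\<lambda>n. Q ^ n * exp (- \<rho> * real n))"
    unfolding eq[symmetric] using assms(1) b(3)
    by (intro bigoI[where c = 1] always_eventually allI) (simp add: power_mono)
  also have "(\<lambda>n::nat. Q ^ n * exp (- \<rho> * real n)) \<in> O(\<lambda>n. Q ^ n * (1 / (real n ^ N * sqrt (real n))))"
    by (intro landau_o.big.mult exp_decay_bigo \<rho>) simp
  finally show ?thesis .
qed

text \<open>Here u(s_0) = h^x (x-1). The Laplace amplitude (h-1)/sqrt h supplies the missing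
  factors: h - 1 = 1/(x-1) lowers the power of x - 1 to n - 1, and 1/sqrt h gives the -1/2 in the
  exponent. The case n = 0 is excluded by the truncated subtraction n - 1 and the division by
  n.\<close>

lemma saddle_point_prefactor:
  fixes x h :: real
  assumes x: "x > 1" and h: "h = x / (x - 1)" and n: "n \<ge> 1"
  shows "fact n / sqrt (2 * pi * real n) * (x - 1) ^ (n - 1) / ln h * h powr (real n * x - 1/2)
    = fact n / (2 * pi) * (exp (x * ln h) / (exp (ln h) - 1)) ^ n
        * ((h - 1) / (sqrt h * ln h) * sqrt (2 * pi / real n))"
proof -
  have h1: "h > 1" "h - 1 = 1 / (x - 1)" using x by (simp_all add: h field_simps)
  have eq: "exp (x * ln h) / (exp (ln h) - 1) = h powr x * (x - 1)"
    using h1 x by (simp add: powr_def)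
  have Qn: "(exp (x * ln h) / (exp (ln h) - 1)) ^ n = h powr (real n * x) * (x - 1) ^ n"
    unfolding eq power_mult_distrib using h1 by (simp add: powr_power)
  have p: "h powr (real n * x - 1/2) = h powr (real n * x) / sqrt h"
    using h1 by (simp add: powr_diff powr_half_sqrt)
  have xn: "(x - 1) ^ n = (x - 1) ^ (n - 1) * (x - 1)" using n by (simp add: power_eq_if)
  have "sqrt (2 * pi / real n) / (2 * pi) = 1 / sqrt (2 * pi * real n)"
  proof -
    have "sqrt (2 * pi) * sqrt (2 * pi) = 2 * pi" by simp
    then show ?thesis using n by (simp add: real_sqrt_divide real_sqrt_mult field_simps)
  qed
  then have "fact n / (2 * pi) * (h powr (real n * x) * (x - 1) ^ n) * ((h - 1) / (sqrt h * ln h) * sqrt (2 * pi / real n))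
    = fact n * (h powr (real n * x) * (x - 1) ^ n) * ((h - 1) / (sqrt h * ln h)) * (1 / sqrt (2 * pi * real n))"
    by (metis (no_types, opaque_lifting) mult.assoc mult.left_commute times_divide_eq_left times_divide_eq_right)
  also have "\<dots> = fact n / sqrt (2 * pi * real n) * (x - 1) ^ (n - 1) / ln h * h powr (real n * x - 1/2)"
    unfolding p xn h1(2) using x by (simp add: mult_ac)
  finally show ?thesis unfolding Qn by simp
qed

lemma gen_bernoulli_integral_expansion:
  fixes h x :: real
  assumes x: "x > 1" and h: "h = x / (x - 1)"
  defines "q \<equiv> \<lambda>\<theta>::real. exp (of_real x * (\<i> * of_real \<theta>)) * of_real (h - 1) / (of_real h * exp (\<i> * of_real \<theta>) - 1)"
  shows "(\<lambda>n::nat. integral {-pi..pi} (\<lambda>\<theta>. q \<theta> ^ n * (1 / (of_real (ln h) + \<i> * of_real \<theta>)))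
     - of_real ((h - 1) / (sqrt h * ln h) * sqrt (2 * pi / real n)) *
       (\<Sum>k<N. of_real (2 ^ k * pochhammer (1/2) k / real n ^ k) * A_coeff k (of_real h) (of_real (ln h))))
   \<in> O(\<lambda>n. of_real (1 / (real n ^ N * sqrt (real n))))"
proof -
  have h1: "h > 1" using x by (simp add: h)
  define H lam :: complex where "H = of_real h" and "lam = of_real (ln h)"
  have H: "H \<noteq> 0" "H \<noteq> 1" and lam: "lam \<noteq> 0" using h1 by (auto simp: H_def lam_def)
  have Hx: "H / (H - 1) = of_real x"
  proof -
    have "h / (h - 1) = x" using x by (simp add: h field_simps)
    then show ?thesis unfolding H_def by (metis of_real_1 of_real_diff of_real_divide)
  qed
  have c: "cH H = \<i> * of_real ((h - 1) / sqrt h)"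
    using h1 by (simp add: cH_def H_def)
  have c0: "cH H \<noteq> 0" using h1 by (simp add: c)
  obtain W where W: "W analytic_on {0}" "W 0 = 0" "deriv W 0 = 1 / cH H"
    and W2: "\<forall>\<^sub>F t in nhds 0. (W t)\<^sup>2 = 2 * (Ln (1 + H/(H-1) * (exp t - 1)) - H/(H-1) * t)"
    by (rule saddle_coordinate_exists[OF H])
  let ?G = "\<lambda>m. fps_nth (fps_deriv (tser H) * inverse (fps_const lam + tser H)) m"
  obtain C where C: "\<forall>\<^sub>F t in nhds 0.
      norm (1 / (lam + t) - (\<Sum>m<2*N. ?G m * W t ^ m) * deriv W t) \<le> C * norm t ^ (2*N)"
    by (rule amplitude_expansion[OF H lam W W2])
  obtain \<kappa> where \<kappa>: "\<kappa> > 0" "\<And>\<theta>. \<bar>\<theta>\<bar> \<le> pi \<Longrightarrow> norm (q \<theta>) \<le> exp (- \<kappa> * \<theta>\<^sup>2)"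
    unfolding q_def using norm_phase_le_gaussian[OF h1, where x = x] by blast
  have ne: "of_real h * exp (\<i> * of_real \<theta>) \<noteq> (1::complex)" for \<theta>
  proof
    assume "of_real h * exp (\<i> * of_real \<theta>) = (1::complex)"
    then have "norm (of_real h * exp (\<i> * of_real \<theta>) :: complex) = 1" by simp
    then show False using h1 by (simp add: norm_mult)
  qed
  have ne': "lam + \<i> * of_real \<theta> \<noteq> 0" for \<theta>
    using h1 by (auto simp: lam_def complex_eq_iff)
  define f where "f = (\<lambda>\<theta>::real. 1 / (lam + \<i> * of_real \<theta>))"
  have "(\<lambda>n::nat. integral {-pi..pi} (\<lambda>\<theta>. q \<theta> ^ n * f \<theta>)
           - (- \<i>) * (\<Sum>m<2*N. ?G m * of_real (gauss_moment m (real n))))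
         \<in> O(\<lambda>n. of_real (1 / (real n ^ N * sqrt (real n))))"
  proof (rule laplace_saddle[where W = W and \<kappa> = \<kappa> and C = C and \<mu> = "sqrt h / (h - 1)"])
    show "continuous_on {-pi..pi} f" unfolding f_def using ne' by (intro continuous_intros) auto
    show "continuous_on {-pi..pi} q" unfolding q_def using ne by (intro continuous_intros) auto
    show "\<i> * deriv W 0 = of_real (sqrt h / (h - 1))" unfolding W(3) c by simp
    show "\<forall>\<^sub>F t in nhds 0. \<forall>\<theta>. t = \<i> * of_real \<theta> \<longrightarrow>
       norm (f \<theta> - (\<Sum>m<2*N. ?G m * W t ^ m) * deriv W t) \<le> C * norm t ^ (2*N)"
      using C by eventually_elim (auto simp: f_def)
    \<comment> \<open>Near 0 the argument of \<open>Ln\<close> is nonzero, so exponentiating undoes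
      the logarithm. As H/(H-1) = x, this identifies exp(-W^2/2) with the phase
      \<open>q\<close>.\<close>
    have "((\<lambda>t::complex. 1 + of_real x * (exp t - 1)) \<longlongrightarrow> 1 + of_real x * (exp 0 - 1)) (nhds 0)"
      by (intro tendsto_intros filterlim_ident)
    then have "\<forall>\<^sub>F t::complex in nhds 0. 1 + of_real x * (exp t - 1) \<noteq> 0"
      by (rule tendsto_imp_eventually_ne) simp
    with W2 show "\<forall>\<^sub>F t in nhds 0. \<forall>\<theta>. t = \<i> * of_real \<theta> \<longrightarrow> q \<theta> = exp (- (W t)\<^sup>2 / 2)"
    proof eventually_elim
      case (elim t)
      have "- (W t)\<^sup>2 / 2 = of_real x * t - Ln (1 + of_real x * (exp t - 1))"
        using elim(1) by (simp add: Hx)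
      then have "exp (- (W t)\<^sup>2 / 2) = exp (of_real x * t) / (1 + of_real x * (exp t - 1))"
        using elim(2) by (simp add: exp_diff)
      also have "1 + of_real x * (exp t - 1) = (of_real h * exp t - 1) / (of_real (h - 1))"
        unfolding Hx[symmetric] using H by (simp add: H_def field_simps)
      finally have "exp (- (W t)\<^sup>2 / 2) = exp (of_real x * t) * of_real (h - 1) / (of_real h * exp t - 1)"
        by simp
      then show ?case by (auto simp: q_def)
    qed
  qed (use \<kappa> W h1 in auto)
  \<comment> \<open>Here -i c = (h-1)/sqrt h, so the leading constant becomes real and
    positive.\<close>
  moreover have "(- \<i>) * (\<Sum>m<2*N. ?G m * of_real (gauss_moment m (real n)))
     = of_real ((h - 1) / (sqrt h * ln h) * sqrt (2 * pi / real n)) *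
       (\<Sum>k<N. of_real (2 ^ k * pochhammer (1/2) k / real n ^ k) * A_coeff k H lam)" for n
    unfolding sum_gauss_moment_A_coeff[OF c0 lam] mult.assoc[symmetric]
    by (rule arg_cong[where f = "\<lambda>z. z * _"]) (simp add: c lam_def)
  ultimately show ?thesis by (simp only: f_def H_def lam_def)
qed

theorem theorem1:
  fixes x :: real
  assumes "x > 1"
  defines "h \<equiv> x / (x - 1)"
  defines "s0 \<equiv> ln h"
  shows "\<forall>N::nat.
    (\<lambda>n::nat. complex_of_real (gen_bernoulli n n (real n * x))
       - complex_of_real (fact n / sqrt (2 * pi * real n) * (x - 1) ^ (n - 1) / ln (x / (x - 1))
                          * (x / (x - 1)) powr (real n * x - 1/2))
         * (\<Sum>k<N. of_real (2 ^ k * pochhammer (1/2) k / real n ^ k)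
                     * A_coeff k (complex_of_real h) (complex_of_real s0)))
    \<in> O(\<lambda>n::nat. complex_of_real (fact n / sqrt (2 * pi * real n) * (x - 1) ^ (n - 1) / ln (x / (x - 1))
                          * (x / (x - 1)) powr (real n * x - 1/2)) / of_nat n ^ N)"
proof
  fix N :: nat
  have h1: "h > 1" using assms(1) by (simp add: h_def)
  then have s0: "s0 > 0" "exp s0 = h" by (simp_all add: s0_def)
  define Q where "Q = exp (x * s0) / (exp s0 - 1)"
  have Q: "Q > 0" using s0 h1 by (simp add: Q_def)
  define \<mu> where "\<mu> = (h - 1) / (sqrt h * s0)"
  have \<mu>: "\<mu> > 0" using h1 s0 by (simp add: \<mu>_def)
  define pre where "pre = (\<lambda>n::nat. fact n / sqrt (2 * pi * real n) * (x - 1) ^ (n - 1) / ln (x / (x - 1))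
                          * (x / (x - 1)) powr (real n * x - 1/2))"
  define S where "S = (\<lambda>n::nat. \<Sum>k<N. of_real (2 ^ k * pochhammer (1/2) k / real n ^ k)
                     * A_coeff k (complex_of_real h) (complex_of_real s0))"
  have pre: "pre n = fact n / (2 * pi) * Q ^ n * (\<mu> * sqrt (2 * pi / real n))" if "n \<ge> 1" for n
    using saddle_point_prefactor[OF assms(1) refl that] by (simp only: pre_def Q_def \<mu>_def s0_def h_def)
  define q where "q = (\<lambda>\<theta>::real. exp (of_real x * (\<i> * of_real \<theta>)) * of_real (h - 1) / (of_real h * exp (\<i> * of_real \<theta>) - 1) :: complex)"
  define I where "I = (\<lambda>n::nat. integral {-pi..pi} (\<lambda>\<theta>. q \<theta> ^ n * (1 / (of_real s0 + \<i> * of_real \<theta>))))"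
  let ?g = "\<lambda>n::nat. 1 / (real n ^ N * sqrt (real n))"
  \<comment> \<open>Common scale of the two errors, the discarded sides (\<open>E1\<close>) and the
    Laplace approximation (\<open>E2\<close>).\<close>
  let ?D = "\<lambda>n::nat. complex_of_real (fact n * (Q ^ n * ?g n))"
  obtain B K where B: "0 \<le> B" "B < Q" and K: "\<And>n. norm (of_real (gen_bernoulli n n (real n * x)) -
        of_real (fact n / (2 * pi)) * integral {-pi..pi} (\<lambda>\<theta>. (exp (of_real x * (of_real s0 + \<i> * of_real \<theta>)) /
           (exp (of_real s0 + \<i> * of_real \<theta>) - 1)) ^ n / (of_real s0 + \<i> * of_real \<theta>)))
      \<le> fact n * (K * B ^ n)"
    unfolding Q_def using gen_bernoulli_rectangle[OF assms(1) s0(1)] by blast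
  \<comment> \<open>Dividing by the value \<open>Q\<close> at the saddle extracts the growth Q^n and
    leaves a phase of modulus at most 1.\<close>
  have uq: "exp (of_real x * (of_real s0 + \<i> * of_real \<theta>)) / (exp (of_real s0 + \<i> * of_real \<theta>) - 1) = of_real Q * q \<theta>" for \<theta>
  proof -
    have "exp (complex_of_real s0) = of_real h" by (metis exp_of_real s0(2))
    moreover have "exp (complex_of_real x * of_real s0) = of_real (exp (x * s0))" by (metis exp_of_real of_real_mult)
    ultimately show ?thesis using h1
      by (simp add: q_def Q_def s0(2) distrib_left exp_add)
  qed
  have int: "integral {-pi..pi} (\<lambda>\<theta>. (exp (of_real x * (of_real s0 + \<i> * of_real \<theta>)) /
           (exp (of_real s0 + \<i> * of_real \<theta>) - 1)) ^ n / (of_real s0 + \<i> * of_real \<theta>)) = of_real Q ^ n * I n" for n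
    unfolding uq I_def by (simp add: power_mult_distrib mult.assoc divide_inverse flip: integral_mult_right)
  have "(\<lambda>n. of_real (gen_bernoulli n n (real n * x)) - of_real (fact n / (2 * pi)) * (of_real Q ^ n * I n))
      \<in> O(\<lambda>n. complex_of_real (fact n * B ^ n))"
    by (rule bigoI[where c = K]) (use K B(1) in \<open>simp add: int norm_mult norm_power mult_ac\<close>)
  also have "(\<lambda>n. complex_of_real (fact n * B ^ n)) \<in> O(?D)"
    unfolding landau_o.big.of_real_iff by (intro landau_o.big.mult geometric_decay_bigo B) simp
  finally have E1: "(\<lambda>n. of_real (gen_bernoulli n n (real n * x)) - of_real (fact n / (2 * pi)) * (of_real Q ^ n * I n)) \<in> O(?D)" .
  have "(\<lambda>n. I n - of_real (\<mu> * sqrt (2 * pi / real n)) * S n) \<in> O(\<lambda>n. of_real (?g n))"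
    unfolding I_def q_def S_def \<mu>_def s0_def
    by (rule gen_bernoulli_integral_expansion[OF assms(1)]) (simp add: h_def)
  then have "(\<lambda>n. complex_of_real (fact n / (2 * pi) * Q ^ n) * (I n - of_real (\<mu> * sqrt (2 * pi / real n)) * S n))
      \<in> O(\<lambda>n. of_real (fact n / (2 * pi) * Q ^ n) * of_real (?g n))"
    by (rule landau_o.big.mult[OF landau_o.big_refl])
  also have "(\<lambda>n. complex_of_real (fact n / (2 * pi) * Q ^ n) * of_real (?g n)) = (\<lambda>n. 1 / (2 * pi) * ?D n)"
    by (simp add: fun_eq_iff)
  also have "O(\<lambda>n. 1 / (2 * pi) * ?D n) = O(?D)" by (rule landau_o.big.cmult) simp
  finally have E2: "(\<lambda>n. complex_of_real (fact n / (2 * pi) * Q ^ n) * (I n - of_real (\<mu> * sqrt (2 * pi / real n)) * S n)) \<in> O(?D)" .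
  have "(\<lambda>n. of_real (gen_bernoulli n n (real n * x)) - of_real (pre n) * S n) \<in> O(?D)"
  proof (rule landau_o.big.in_cong[THEN iffD2])
    show "\<forall>\<^sub>F n in sequentially. of_real (gen_bernoulli n n (real n * x)) - of_real (pre n) * S n
      = (of_real (gen_bernoulli n n (real n * x)) - of_real (fact n / (2 * pi)) * (of_real Q ^ n * I n))
       + complex_of_real (fact n / (2 * pi) * Q ^ n) * (I n - of_real (\<mu> * sqrt (2 * pi / real n)) * S n)"
      by (rule eventually_sequentiallyI[of 1]) (simp add: pre algebra_simps)
    show "(\<lambda>n. (of_real (gen_bernoulli n n (real n * x)) - of_real (fact n / (2 * pi)) * (of_real Q ^ n * I n))
       + complex_of_real (fact n / (2 * pi) * Q ^ n) * (I n - of_real (\<mu> * sqrt (2 * pi / real n)) * S n)) \<in> O(?D)"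
      using E1 E2 by (rule sum_in_bigo)
  qed
  also have "?D \<in> O(\<lambda>n. of_real (pre n) / of_nat n ^ N)"
  \<comment> \<open>With this constant the bound is an equality: it cancels \<mu> and turns sqrt(2
    pi / n)/(2 pi) into 1/sqrt n.\<close>
  proof (rule bigoI[where c = "sqrt (2 * pi) / \<mu>"])
    show "\<forall>\<^sub>F n in sequentially. norm (?D n) \<le> sqrt (2 * pi) / \<mu> * norm (complex_of_real (pre n) / of_nat n ^ N)"
    proof (rule eventually_sequentiallyI[of 1])
      fix n :: nat assume n: "n \<ge> 1"
      have "sqrt (2 * pi) / \<mu> * (pre n / real n ^ N) = fact n * (Q ^ n * ?g n)"
      proof -
        have "sqrt (2 * pi) * sqrt (2 * pi) = 2 * pi" by simp
        then show ?thesis unfolding pre[OF n] using \<mu> n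
          by (simp add: real_sqrt_divide field_simps)
      qed
      moreover have "norm (?D n) = fact n * (Q ^ n * ?g n)"
        using Q by (simp only: norm_of_real) (simp add: abs_mult)
      moreover have "norm (complex_of_real (pre n) / of_nat n ^ N) = pre n / real n ^ N"
        using Q \<mu> by (simp add: pre[OF n] norm_divide norm_mult norm_power)
      ultimately show "norm (?D n) \<le> sqrt (2 * pi) / \<mu> * norm (complex_of_real (pre n) / of_nat n ^ N)" by simp
    qed
  qed
  finally show "(\<lambda>n::nat. complex_of_real (gen_bernoulli n n (real n * x))
       - complex_of_real (fact n / sqrt (2 * pi * real n) * (x - 1) ^ (n - 1) / ln (x / (x - 1))
                          * (x / (x - 1)) powr (real n * x - 1/2))
         * (\<Sum>k<N. of_real (2 ^ k * pochhammer (1/2) k / real n ^ k)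
                     * A_coeff k (complex_of_real h) (complex_of_real s0)))
    \<in> O(\<lambda>n::nat. complex_of_real (fact n / sqrt (2 * pi * real n) * (x - 1) ^ (n - 1) / ln (x / (x - 1))
                          * (x / (x - 1)) powr (real n * x - 1/2)) / of_nat n ^ N)"
    by (simp only: pre_def S_def)
qed

end
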